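(* Suppose Assumption (B) of the context is satisfied with some $\iota\in[0,1/2]$, and let $\xi\in D(A^\iota)$. Then $$\bigg(\sum_{\eta=1}^N\mathbb E\big[\|\widehat X^{J,L}(\tau_\eta)\|_{D(A^{\iota+1/2})}^2\big](\tau_\eta-\tau_{\eta-1})\bigg)^{1/2}\preceq\|\mathscr P_J\xi\|_{D(A^\iota)}$$ $$+\bigg(\mathbb E\bigg[\sum_{\ell=1}^\infty\sum_{i=1}^{n_\ell}\big\|\mathscr P_JB(t_{i-1,\ell},\widehat X^{J,L}(t_{i-1,\ell}))\mathscr P_L\sqrt{q_\ell}h_\ell\big\|_{D(A^\iota)}^2(t_{i,\ell}-t_{i-1,\ell})\bigg]\bigg)^{1/2}.$$ In particular, the uniform-step approximation $\overline X^{J,L}$ with $N$ steps (that is, the case $n_\ell=N$ for all $\ell=1,\dots,L$, with $t_i=i/N$) satisfies $$\bigg(\sum_{i=1}^N\mathbb E\big[\|\overline X^{J,L}(t_i)\|_{D(A^{\iota+1/2})}^2\big](t_i-t_{i-1})\bigg)^{1/2}\preceq\|\mathscr P_J\xi\|_{D(A^\iota)}$$ $$+\bigg(\sum_{i=1}^N\mathbb E\Big[\big\|\mathscr P_JB(t_{i-1},\overline X^{J,L}(t_{i-1}))\mathscr P_L\big\|_{\mathcal L_2(H_0,D(A^\iota))}^2\Big](t_i-t_{i-1})\bigg)^{1/2}.$$ Here $a\preceq b$ means $a\le Cb$ with a constant $C>0$ that is uniform with respect to any parameters on which $a$ and $b$ may depend (in particular $J$, $L$, $N$, the $n_\ell$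 and $\xi$).
   Context: $(H,\langle\cdot,\cdot\rangle,\|\cdot\|)$ is a separable real Hilbert space. $-A:D(A)\subset H\to H$ is a densely defined, self-adjoint, positive definite linear operator with compact inverse. There is a complete orthonormal system $\{h_j\}_{j\ge1}$ of $H$ with $-Ah_j=\lambda_jh_j$, each eigenspace one-dimensional, $0<\lambda_1<\lambda_2<\cdots$, $\lambda_j\to\infty$ (if $H$ is infinite-dimensional). For $r\ge0$, $D(A^r)=\{x\in H:\|x\|_{D(A^r)}^2:=\sum_{j\ge1}\lambda_j^{2r}\langle x,h_j\rangle^2<\infty\}$. $(\Omega,\mathscr F,\mathbb P)$ is a probability space with a filtration satisfying the usual conditions, and $W:[0,1]\times\Omega\to H$ is a $Q$-Wiener process adapted to it, where $Q$ is trace class with $Qh_\ell=q_\ell h_\ell$, $q_\ell\ge0$, $\sum_\ell q_\ell<\infty$. Thus $W(t)=\sum_{\ell\ge1}\sqrt{q_\ell}\,\beta_\ell(t)h_\ell$ with independent standard one-dimensional Brownian motions $\beta_\ell$ started at zero. $H_0=Q^{1/2}(H)$ with inner product $\langle g_1,g_2\rangle_0=\langle Q^{-1/2}g_1,Q^{-1/2}g_2\rangle$ ($Q^{-1/2}$ the pseudo-inverse of $Q^{1/2}$). $\mathcal L_2(H_0,K)$ denotes Hilbert--Schmidt operators from $H_0$ to $K$, so $\|T\|^2_{\mathcal L_2(H_0,K)}=\sum_{\ell\ge1}\|T(\sqrt{q_\ell}h_\ell)\|_K^2$. Assumption (B) with $\iota\in[0,1/2]$: $B:[0,1]\times H\to\mathcal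 L_2(H_0,H)$ is Borel measurable; there is a constant $C_B$ with $\|B(t,u)-B(t,v)\|_{\mathcal L_2(H_0,H)}\le C_B\|u-v\|$ for all $t\in[0,1]$, $u,v\in H$; and for all $t\in[0,1]$, $u\in D(A^\iota)$, $B(t,u)\in\mathcal L_2(H_0,D(A^\iota))$ with $\|B(t,u)\|_{\mathcal L_2(H_0,D(A^\iota))}\le C_B(1+\|u\|_{D(A^\iota)})$. Grid: $J,L\in\mathbb N$ and $n_1,\dots,n_L\in\mathbb N$; $t_{i,\ell}=i/n_\ell$ for $i=0,\dots,n_\ell$; $0=\tau_0<\tau_1<\dots<\tau_N=1$ are the distinct elements of $\bigcup_{\ell=1}^L\{t_{0,\ell},\dots,t_{n_\ell,\ell}\}$. For $\tau_{\eta_1}\le\tau_{\eta_2}$, $\mathfrak R_j(\tau_{\eta_1},\tau_{\eta_2})=\prod_{\nu=\eta_1+1}^{\eta_2}\frac1{1+\lambda_j(\tau_\nu-\tau_{\nu-1})}$ (empty product $=1$). For $M\in\mathbb N$ (used with $M=J$ and $M=L$), $\mathscr P_Mx=\sum_{j=1}^M\langle x,h_j\rangle h_j$. In sums over $\ell\ge1$ containing $\mathscr P_L\sqrt{q_\ell}h_\ell$, the terms with $\ell>L$ are zero (since $\mathscr P_Lh_\ell=0$). Scheme (implicit Euler--Maruyama with non-uniform time discretisation), with deterministic initial value $\xi$: $\widehat X^{J,L}(\tau_\eta)=\sum_{j=1}^J\widehat X^{J,L}_j(\tau_\eta)h_j$ is defined recursively by $\widehat X^{J,L}(\tau_0)=\mathscr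 P_J\xi$ and, for $\eta=1,\dots,N$, $$\widehat X_j^{J,L}(\tau_\eta)=\mathfrak R_j(\tau_0,\tau_\eta)\langle\xi,h_j\rangle+\sum_{\ell=1}^L\sum_{\tau_1\le t_{i,\ell}\le\tau_\eta}\mathfrak R_j(t_{i-1,\ell},\tau_\eta)\big\langle B(t_{i-1,\ell},\widehat X^{J,L}(t_{i-1,\ell}))\sqrt{q_\ell}h_\ell,h_j\big\rangle\big(\beta_\ell(t_{i,\ell})-\beta_\ell(t_{i-1,\ell})\big).$$ Uniform scheme: with $t_i=i/N$, $\overline X^{J,L}(t_i)=\sum_{j=1}^J\overline X_j^{J,L}(t_i)h_j$, where $\overline X_j^{J,L}(0)=\langle\xi,h_j\rangle$ and, for $i=1,\dots,N$, $$\overline X_j^{J,L}(t_i)=\Big(1+\frac{\lambda_j}N\Big)^{-1}\Big(\overline X_j^{J,L}(t_{i-1})+\sum_{\ell=1}^L\big\langle B(t_{i-1},\overline X^{J,L}(t_{i-1}))\sqrt{q_\ell}h_\ell,h_j\big\rangle(\beta_\ell(t_i)-\beta_\ell(t_{i-1}))\Big).$$ This is $\widehat X^{J,L}$ in the case $n_\ell=N$ for all $\ell=1,\dots,L$. *)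

theory Defs
  imports "HOL-Probability.Probability"
begin

section \<open>The operator and its eigenbasis\<close>

definition positive_definite_selfadjoint ::
    "'h::{real_inner, complete_space} set \<Rightarrow> ('h \<Rightarrow> 'h) \<Rightarrow> bool" where
  "positive_definite_selfadjoint D S \<longleftrightarrow>
     subspace D \<and> closure D = UNIV
   \<and> (\<forall>x\<in>D. \<forall>y\<in>D. S (x + y) = S x + S y) \<and> (\<forall>c. \<forall>x\<in>D. S (c *\<^sub>R x) = c *\<^sub>R S x)
   \<and> {y. \<exists>z. \<forall>x\<in>D. inner (S x) y = inner x z} = D
   \<and> (\<forall>x\<in>D. \<forall>y\<in>D. inner (S x) y = inner x (S y))
   \<and> (\<forall>x\<in>D. x \<noteq> 0 \<longrightarrow> inner (S x) x > 0)"

definition has_compact_inverse ::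
    "'h::real_normed_vector set \<Rightarrow> ('h \<Rightarrow> 'h) \<Rightarrow> bool" where
  "has_compact_inverse D S \<longleftrightarrow>
     bij_betw S D UNIV \<and> compact (closure (inv_into D S ` cball 0 1))"

text \<open>
  The eigenvectors are indexed by a set \<open>I\<close>, which is \<open>{1..}\<close> for an infinite-dimensional and
  \<open>{1..d}\<close> for a \<open>d\<close>-dimensional space; \<open>h j\<close> and \<open>lam j\<close> are never used for \<open>j \<notin> I\<close>.
\<close>

definition spectral_setting ::
    "nat set \<Rightarrow> 'h::{real_inner, complete_space} set \<Rightarrow> ('h \<Rightarrow> 'h) \<Rightarrow> (nat \<Rightarrow> 'h) \<Rightarrow> (nat \<Rightarrow> real) \<Rightarrow> bool"
  where
  "spectral_setting I D A h lam \<longleftrightarrow>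
     (I = {1..} \<or> (\<exists>d\<ge>1. I = {1..d}))
   \<and> positive_definite_selfadjoint D (\<lambda>x. - A x)
   \<and> has_compact_inverse D (\<lambda>x. - A x)
   \<and> (\<forall>j\<in>I. \<forall>k\<in>I. inner (h j) (h k) = (if j = k then 1 else 0))
   \<and> closure (span (h ` I)) = UNIV
   \<and> (\<forall>j\<in>I. h j \<in> D \<and> - A (h j) = lam j *\<^sub>R h j)
   \<and> (\<forall>j\<in>I. {x \<in> D. - A x = lam j *\<^sub>R x} = span {h j})
   \<and> (\<forall>j\<in>I. 0 < lam j) \<and> strict_mono_on I lam
   \<and> (infinite I \<longrightarrow> filterlim lam at_top sequentially)"

definition Dom_pow ::
    "nat set \<Rightarrow> (nat \<Rightarrow> 'h::real_inner) \<Rightarrow> (nat \<Rightarrow> real) \<Rightarrow> real \<Rightarrow> 'h set" where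
  "Dom_pow I h lam r = {x. (\<lambda>j. lam j powr (2 * r) * (inner x (h j))\<^sup>2) summable_on I}"

definition norm_pow ::
    "nat set \<Rightarrow> (nat \<Rightarrow> 'h::real_inner) \<Rightarrow> (nat \<Rightarrow> real) \<Rightarrow> real \<Rightarrow> 'h \<Rightarrow> real" where
  "norm_pow I h lam r x = sqrt (\<Sum>\<^sub>\<infinity>j\<in>I. lam j powr (2 * r) * (inner x (h j))\<^sup>2)"

definition eig_proj :: "nat set \<Rightarrow> (nat \<Rightarrow> 'h::real_inner) \<Rightarrow> nat \<Rightarrow> 'h \<Rightarrow> 'h" where
  "eig_proj I h m x = (\<Sum>j\<in>{1..m} \<inter> I. inner x (h j) *\<^sub>R h j)"


section \<open>The covariance operator and Hilbert--Schmidt operators\<close>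

definition trace_class_covariance ::
    "nat set \<Rightarrow> (nat \<Rightarrow> 'h::{real_inner, complete_space}) \<Rightarrow> ('h \<Rightarrow> 'h) \<Rightarrow> (nat \<Rightarrow> real) \<Rightarrow> bool" where
  "trace_class_covariance I h Q q \<longleftrightarrow>
     bounded_linear Q \<and> (\<forall>l\<in>I. Q (h l) = q l *\<^sub>R h l \<and> 0 \<le> q l) \<and> q summable_on I"

definition Q_half ::
    "nat set \<Rightarrow> (nat \<Rightarrow> 'h::real_inner) \<Rightarrow> (nat \<Rightarrow> real) \<Rightarrow> 'h \<Rightarrow> 'h" where
  "Q_half I h q x = (\<Sum>\<^sub>\<infinity>l\<in>I. (sqrt (q l) * inner x (h l)) *\<^sub>R h l)"

definition H0 ::
    "nat set \<Rightarrow> (nat \<Rightarrow> 'h::real_inner) \<Rightarrow> (nat \<Rightarrow> real) \<Rightarrow> 'h set" where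
  "H0 I h q = range (Q_half I h q)"

text \<open>Pseudo-inverse: the preimage in the orthogonal complement of the kernel.\<close>

definition Q_minus_half ::
    "nat set \<Rightarrow> (nat \<Rightarrow> 'h::real_inner) \<Rightarrow> (nat \<Rightarrow> real) \<Rightarrow> 'h \<Rightarrow> 'h" where
  "Q_minus_half I h q g =
     (THE x. Q_half I h q x = g \<and> (\<forall>y. Q_half I h q y = 0 \<longrightarrow> inner x y = 0))"

definition norm_H0 ::
    "nat set \<Rightarrow> (nat \<Rightarrow> 'h::real_inner) \<Rightarrow> (nat \<Rightarrow> real) \<Rightarrow> 'h \<Rightarrow> real" where
  "norm_H0 I h q g = norm (Q_minus_half I h q g)"

text \<open>
  A Hilbert--Schmidt operator from \<open>H0\<close> to a subspace \<open>K\<close> with norm \<open>nK\<close> is represented by a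
  function on the whole space, of which only the values on \<open>H0\<close> matter.  The vectors
  \<open>sqrt (q l) *\<^sub>R h l\<close> with \<open>q l > 0\<close> form an orthonormal basis of \<open>H0\<close>.
\<close>

definition HS_norm ::
    "nat set \<Rightarrow> (nat \<Rightarrow> 'h::real_inner) \<Rightarrow> (nat \<Rightarrow> real) \<Rightarrow> ('h \<Rightarrow> real) \<Rightarrow> ('h \<Rightarrow> 'h) \<Rightarrow> real" where
  "HS_norm I h q nK T = sqrt (\<Sum>\<^sub>\<infinity>l\<in>I. (nK (T (sqrt (q l) *\<^sub>R h l)))\<^sup>2)"

definition HS ::
    "nat set \<Rightarrow> (nat \<Rightarrow> 'h::real_inner) \<Rightarrow> (nat \<Rightarrow> real) \<Rightarrow> 'h set \<Rightarrow> ('h \<Rightarrow> real) \<Rightarrow> ('h \<Rightarrow> 'h) set" where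
  "HS I h q K nK =
     {T. (\<forall>g\<in>H0 I h q. T g \<in> K)
       \<and> (\<forall>g\<in>H0 I h q. \<forall>g'\<in>H0 I h q. T (g + g') = T g + T g')
       \<and> (\<forall>c. \<forall>g\<in>H0 I h q. T (c *\<^sub>R g) = c *\<^sub>R T g)
       \<and> (\<exists>c. \<forall>g\<in>H0 I h q. nK (T g) \<le> c * norm_H0 I h q g)
       \<and> (\<lambda>l. (nK (T (sqrt (q l) *\<^sub>R h l)))\<^sup>2) summable_on I}"

text \<open>
  The Borel sigma-algebra of the Hilbert--Schmidt operators from \<open>H0\<close> to \<open>H\<close>, generated by the
  sets that are open for the Hilbert--Schmidt norm.
\<close>

definition HS_borel ::
    "nat set \<Rightarrow> (nat \<Rightarrow> 'h::real_inner) \<Rightarrow> (nat \<Rightarrow> real) \<Rightarrow> ('h \<Rightarrow> 'h) measure" where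
  "HS_borel I h q = sigma (HS I h q UNIV norm)
     {U. U \<subseteq> HS I h q UNIV norm \<and>
         (\<forall>T\<in>U. \<exists>e>0. \<forall>S\<in>HS I h q UNIV norm. HS_norm I h q norm (\<lambda>g. S g - T g) < e \<longrightarrow> S \<in> U)}"

definition assumption_B ::
    "nat set \<Rightarrow> (nat \<Rightarrow> 'h::{real_inner, complete_space, second_countable_topology}) \<Rightarrow> (nat \<Rightarrow> real) \<Rightarrow>
     (nat \<Rightarrow> real) \<Rightarrow> real \<Rightarrow> (real \<Rightarrow> 'h \<Rightarrow> 'h \<Rightarrow> 'h) \<Rightarrow> bool" where
  "assumption_B I h lam q r B \<longleftrightarrow>
     (\<lambda>(t, u). B t u) \<in> measurable (restrict_space borel ({0..1} \<times> UNIV)) (HS_borel I h q)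
   \<and> (\<exists>C.
        (\<forall>t\<in>{0..1}. \<forall>u v.
           HS_norm I h q norm (\<lambda>g. B t u g - B t v g) \<le> C * norm (u - v))
      \<and> (\<forall>t\<in>{0..1}. \<forall>u\<in>Dom_pow I h lam r.
           B t u \<in> HS I h q (Dom_pow I h lam r) (norm_pow I h lam r)
         \<and> HS_norm I h q (norm_pow I h lam r) (B t u) \<le> C * (1 + norm_pow I h lam r u)))"


section \<open>Filtration and Wiener process\<close>

definition usual_filtration :: "'w measure \<Rightarrow> (real \<Rightarrow> 'w measure) \<Rightarrow> bool" where
  "usual_filtration M F \<longleftrightarrow>
     (\<forall>t\<in>{0..1}. subalgebra M (F t))
   \<and> (\<forall>s\<in>{0..1}. \<forall>t\<in>{0..1}. s \<le> t \<longrightarrow> sets (F s) \<subseteq> sets (F t))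
   \<and> (\<forall>t\<in>{0..<1}. sets (F t) = (\<Inter>s\<in>{t<..1}. sets (F s)))
   \<and> null_sets M \<subseteq> sets (F 0)"

text \<open>Normal distribution with mean zero and variance \<open>v\<close>, where \<open>v = 0\<close> is allowed.\<close>

definition centred_gaussian :: "'w measure \<Rightarrow> ('w \<Rightarrow> real) \<Rightarrow> real \<Rightarrow> bool" where
  "centred_gaussian M X v \<longleftrightarrow>
     X \<in> borel_measurable M
   \<and> (if v = 0 then (AE w in M. X w = 0)
      else v > 0 \<and> distributed M lborel X (normal_density 0 (sqrt v)))"

definition independent_increments ::
    "'w measure \<Rightarrow> (real \<Rightarrow> 'w \<Rightarrow> 'b::{real_normed_vector, second_countable_topology}) \<Rightarrow> bool" where
  "independent_increments M X \<longleftrightarrow>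
     (\<forall>(m::nat) s. (\<forall>i\<le>m. s i \<in> {0..1}) \<and> (\<forall>i<m. s i \<le> s (Suc i)) \<longrightarrow>
        prob_space.indep_vars M (\<lambda>_. borel) (\<lambda>i w. X (s (Suc i)) w - X (s i) w) {..<m})"

definition standard_brownian_motion :: "'w measure \<Rightarrow> (real \<Rightarrow> 'w \<Rightarrow> real) \<Rightarrow> bool" where
  "standard_brownian_motion M b \<longleftrightarrow>
     (\<forall>t\<in>{0..1}. b t \<in> borel_measurable M)
   \<and> (AE w in M. b 0 w = 0)
   \<and> (AE w in M. continuous_on {0..1} (\<lambda>t. b t w))
   \<and> independent_increments M b
   \<and> (\<forall>s\<in>{0..1}. \<forall>t\<in>{0..1}. s \<le> t \<longrightarrow> centred_gaussian M (\<lambda>w. b t w - b s w) (t - s))"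

definition Q_wiener_process ::
    "'w measure \<Rightarrow> ('h \<Rightarrow> 'h) \<Rightarrow>
     (real \<Rightarrow> 'w \<Rightarrow> 'h::{real_inner, complete_space, second_countable_topology}) \<Rightarrow> bool" where
  "Q_wiener_process M Q W \<longleftrightarrow>
     (\<forall>t\<in>{0..1}. W t \<in> borel_measurable M)
   \<and> (AE w in M. W 0 w = 0)
   \<and> (AE w in M. continuous_on {0..1} (\<lambda>t. W t w))
   \<and> independent_increments M W
   \<and> (\<forall>s\<in>{0..1}. \<forall>t\<in>{0..1}. s \<le> t \<longrightarrow>
        (\<forall>x. centred_gaussian M (\<lambda>w. inner (W t w - W s w) x) ((t - s) * inner (Q x) x)))"

definition wiener_setting ::
    "'w measure \<Rightarrow> (real \<Rightarrow> 'w measure) \<Rightarrow> nat set \<Rightarrow>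
     (nat \<Rightarrow> 'h::{real_inner, complete_space, second_countable_topology}) \<Rightarrow>
     ('h \<Rightarrow> 'h) \<Rightarrow> (nat \<Rightarrow> real) \<Rightarrow> (real \<Rightarrow> 'w \<Rightarrow> 'h) \<Rightarrow> (nat \<Rightarrow> real \<Rightarrow> 'w \<Rightarrow> real) \<Rightarrow> bool" where
  "wiener_setting M F I h Q q W beta \<longleftrightarrow>
     prob_space M
   \<and> usual_filtration M F
   \<and> trace_class_covariance I h Q q
   \<and> Q_wiener_process M Q W
   \<and> (\<forall>t\<in>{0..1}. W t \<in> borel_measurable (F t))
   \<and> (\<forall>l\<in>I. standard_brownian_motion M (beta l))
   \<and> prob_space.indep_vars M (\<lambda>_. PiM {0..1} (\<lambda>_. borel)) (\<lambda>l w. \<lambda>t\<in>{0..1}. beta l t w) I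
   \<and> (\<forall>t\<in>{0..1}. AE w in M. ((\<lambda>l. (sqrt (q l) * beta l t w) *\<^sub>R h l) has_sum W t w) I)"


section \<open>The time grid and the implicit Euler schemes\<close>

text \<open>The grid point \<open>t\<^sub>i\<^sub>,\<^sub>l\<close> is \<open>real i / real (n l)\<close>.\<close>

definition grid :: "nat \<Rightarrow> (nat \<Rightarrow> nat) \<Rightarrow> real set" where
  "grid L n = (\<Union>l\<in>{1..L}. (\<lambda>i. real i / real (n l)) ` {0..n l})"

definition tau :: "nat \<Rightarrow> (nat \<Rightarrow> nat) \<Rightarrow> nat \<Rightarrow> real" where
  "tau L n k = sorted_list_of_set (grid L n) ! k"

definition num_steps :: "nat \<Rightarrow> (nat \<Rightarrow> nat) \<Rightarrow> nat" where
  "num_steps L n = card (grid L n) - 1"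

text \<open>
  For \<open>s = tau L n k\<close> and \<open>t = tau L n m\<close> with \<open>k \<le> m\<close>, the product below ranges over
  \<open>{k+1..m}\<close>.
\<close>

definition resolvent_prod :: "(nat \<Rightarrow> real) \<Rightarrow> nat \<Rightarrow> (nat \<Rightarrow> nat) \<Rightarrow> nat \<Rightarrow> real \<Rightarrow> real \<Rightarrow> real" where
  "resolvent_prod lam L n j s t =
     (\<Prod>k\<in>{k\<in>{1..num_steps L n}. s < tau L n k \<and> tau L n k \<le> t}.
        1 / (1 + lam j * (tau L n k - tau L n (k - 1))))"

lemma finite_grid: "finite (grid L n)"
  by (simp add: grid_def)

text \<open>
  The scheme is a function of the real time \<open>s\<close>; only its values at grid points are relevant.
  The summation condition \<open>\<tau>\<^sub>1 \<le> t\<^sub>i\<^sub>,\<^sub>l\<close> of the scheme just says \<open>i \<ge> 1\<close>.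
\<close>

context
  fixes I :: "nat set" and h :: "nat \<Rightarrow> 'h::real_inner" and lam q :: "nat \<Rightarrow> real"
    and B :: "real \<Rightarrow> 'h \<Rightarrow> 'h \<Rightarrow> 'h" and beta :: "nat \<Rightarrow> real \<Rightarrow> 'w \<Rightarrow> real"
    and xi :: 'h and J L :: nat
begin

function X_hat :: "(nat \<Rightarrow> nat) \<Rightarrow> real \<Rightarrow> 'w \<Rightarrow> 'h" where
  "X_hat n s w =
     (\<Sum>j\<in>{1..J} \<inter> I.
        (resolvent_prod lam L n j 0 s * inner xi (h j)
         + (\<Sum>l\<in>{1..L} \<inter> I. \<Sum>i\<in>{i\<in>{1..n l}. real i / real (n l) \<le> s}.
              resolvent_prod lam L n j (real (i - 1) / real (n l)) s
              * inner (B (real (i - 1) / real (n l)) (X_hat n (real (i - 1) / real (n l)) w)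
                         (sqrt (q l) *\<^sub>R h l)) (h j)
              * (beta l (real i / real (n l)) w - beta l (real (i - 1) / real (n l)) w)))
        *\<^sub>R h j)"
  by pat_completeness auto
termination
proof (relation "Wellfounded.measure (\<lambda>(n, s, w). card {r \<in> grid L n. r < s})")
  fix n :: "nat \<Rightarrow> nat" and s :: real and w :: 'w and j l i :: nat
  assume l: "l \<in> {1..L} \<inter> I" and i: "i \<in> {i\<in>{1..n l}. real i / real (n l) \<le> s}"
  let ?r = "real (i - 1) / real (n l)"
  have "i - 1 \<in> {0..n l}" using i by auto
  then have mem: "?r \<in> grid L n" using l unfolding grid_def by blast
  have "real (i - 1) / real (n l) < real i / real (n l)"
    using i by (intro divide_strict_right_mono) auto
  then have lt: "?r < s" using i by auto
  then have "{r \<in> grid L n. r < ?r} \<subset> {r \<in> grid L n. r < s}" using mem by auto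
  then have "card {r \<in> grid L n. r < ?r} < card {r \<in> grid L n. r < s}"
    by (intro psubset_card_mono) (auto simp: finite_grid)
  then show "((n, ?r, w), (n, s, w)) \<in> Wellfounded.measure (\<lambda>(n, s, w). card {r \<in> grid L n. r < s})"
    by simp
qed simp

text \<open>\<open>X_bar_comp N i w j\<close> is the \<open>j\<close>-th component of the uniform scheme at time \<open>i / N\<close>.\<close>

primrec X_bar_comp :: "nat \<Rightarrow> nat \<Rightarrow> 'w \<Rightarrow> nat \<Rightarrow> real" where
  "X_bar_comp N 0 w = (\<lambda>j. inner xi (h j))"
| "X_bar_comp N (Suc i) w = (\<lambda>j.
     inverse (1 + lam j / real N) *
       (X_bar_comp N i w j
        + (\<Sum>l\<in>{1..L} \<inter> I.
             inner (B (real i / real N) (\<Sum>k\<in>{1..J} \<inter> I. X_bar_comp N i w k *\<^sub>R h k)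
                      (sqrt (q l) *\<^sub>R h l)) (h j)
             * (beta l (real (Suc i) / real N) w - beta l (real i / real N) w))))"

definition X_bar :: "nat \<Rightarrow> nat \<Rightarrow> 'w \<Rightarrow> 'h" where
  "X_bar N i w = (\<Sum>j\<in>{1..J} \<inter> I. X_bar_comp N i w j *\<^sub>R h j)"

end

declare X_hat.simps [simp del]

end

theory Submission
  imports Defs
begin

text \<open>
  The scheme depends only on the increments of the Brownian motions over the cells of the joint
  grid, and these form one independent family.  Hence the noise terms of each spectral component
  are orthogonal, and the second moment of the \<open>j\<close>-th component at \<open>\<tau> \<eta>\<close> is the sum of the squared
  initial value and of the energies of the noise terms, each weighted with a squared resolvent
  product.  With \<open>x = lam j * (\<tau> \<eta> - \<tau> (\<eta> - 1))\<close> the resolvent product satisfies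
  \<open>x * R \<eta> = R (\<eta> - 1) - R \<eta>\<close>, so \<open>x * (R \<eta>)^2\<close> sums to at most 1 over \<open>\<eta>\<close>.  This gains half a
  power of the operator with constant 1.  The Lipschitz bound on \<open>B\<close> makes all coefficients
  measurable and square integrable, so that no Bochner integral takes its junk value 0.
\<close>

section \<open>Independent increments and orthogonal sums\<close>

text \<open>Rows are independent as whole random elements \<open>Y l\<close>, and entries are
  independent inside each row. An event on \<open>S \<times> T\<close> therefore factorises twice,
  first over the rows and then within each row.\<close>

lemma (in prob_space) indep_vars_Times:
  fixes Z :: "'i \<Rightarrow> 'j \<Rightarrow> 'b \<Rightarrow> 'c::topological_space"
  assumes fin: "finite S" "finite T"
    and rows: "indep_vars N Y S"
    and Z: "\<And>l k. l \<in> S \<Longrightarrow> k \<in> T \<Longrightarrow> Z l k \<in> borel_measurable (N l)"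
    and cols: "\<And>l. l \<in> S \<Longrightarrow> indep_vars (\<lambda>_. borel) (\<lambda>k w. Z l k (Y l w)) T"
  shows "indep_vars (\<lambda>_. borel) (\<lambda>(l, k) w. Z l k (Y l w)) (S \<times> T)"
proof (cases "S = {} \<or> T = {}")
  \<comment> \<open>The finite product criterion used in the other case requires a nonempty index
    set.\<close>
  case True
  then have "S \<times> T = {}" by auto
  then show ?thesis by (simp add: indep_vars_def indep_sets_def del: Times_empty)
next
  case False
  have Y: "Y l \<in> measurable M (N l)" if "l \<in> S" for l
    using rows that by (auto simp: indep_vars_def)
  show ?thesis
  proof (subst indep_vars_finite[where E="\<lambda>_. sets borel"])
    show "\<forall>A\<in>(S \<times> T) \<rightarrow> sets borel.
      prob (\<Inter>p\<in>S \<times> T. (case p of (l, k) \<Rightarrow> \<lambda>w. Z l k (Y l w)) -` A p \<inter> space M)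
      = (\<Prod>p\<in>S \<times> T. prob ((case p of (l, k) \<Rightarrow> \<lambda>w. Z l k (Y l w)) -` A p \<inter> space M))"
    proof
      fix A :: "'i \<times> 'j \<Rightarrow> 'c set" assume A: "A \<in> (S \<times> T) \<rightarrow> sets borel"
      \<comment> \<open>\<open>C l\<close> packs all conditions on row \<open>l\<close> into one
        measurable event for \<open>Y l\<close>, so that independence of the rows applies to
        it.\<close>
      define C where "C l = {y \<in> space (N l). \<forall>k\<in>T. Z l k y \<in> A (l, k)}" for l
      have C: "C l \<in> sets (N l)" if "l \<in> S" for l
      proof -
        have "C l = (\<Inter>k\<in>T. Z l k -` A (l, k) \<inter> space (N l))"
          using False by (auto simp: C_def)
        also have "\<dots> \<in> sets (N l)"
          using False fin that A by (intro sets.finite_INT measurable_sets[OF Z]) auto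
        finally show ?thesis .
      qed
      have C_eq: "Y l -` C l \<inter> space M = (\<Inter>k\<in>T. (\<lambda>w. Z l k (Y l w)) -` A (l, k) \<inter> space M)"
        if "l \<in> S" for l
        using False measurable_space[OF Y[OF that]] by (auto simp: C_def)
      have "(\<Inter>p\<in>S \<times> T. (case p of (l, k) \<Rightarrow> \<lambda>w. Z l k (Y l w)) -` A p \<inter> space M)
          = (\<Inter>l\<in>S. \<Inter>k\<in>T. (\<lambda>w. Z l k (Y l w)) -` A (l, k) \<inter> space M)"
        by auto
      also have "\<dots> = (\<Inter>l\<in>S. Y l -` C l \<inter> space M)"
        using C_eq by (intro INF_cong) simp_all
      also have "prob \<dots> = (\<Prod>l\<in>S. prob (Y l -` C l \<inter> space M))"
        using False fin C by (intro indep_varsD_finite[OF rows]) auto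
      also have "\<dots> = (\<Prod>l\<in>S. \<Prod>k\<in>T. prob ((\<lambda>w. Z l k (Y l w)) -` A (l, k) \<inter> space M))"
      proof (rule prod.cong[OF refl])
        fix l assume l: "l \<in> S"
        show "prob (Y l -` C l \<inter> space M)
            = (\<Prod>k\<in>T. prob ((\<lambda>w. Z l k (Y l w)) -` A (l, k) \<inter> space M))"
          unfolding C_eq[OF l] using False fin A l
          by (intro indep_varsD_finite[OF cols]) auto
      qed
      also have "\<dots> = (\<Prod>p\<in>S \<times> T. prob ((case p of (l, k) \<Rightarrow> \<lambda>w. Z l k (Y l w)) -` A p \<inter> space M))"
        by (simp add: prod.cartesian_product split_beta)
      finally show "prob (\<Inter>p\<in>S \<times> T. (case p of (l, k) \<Rightarrow> \<lambda>w. Z l k (Y l w)) -` A p \<inter> space M)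
        = (\<Prod>p\<in>S \<times> T. prob ((case p of (l, k) \<Rightarrow> \<lambda>w. Z l k (Y l w)) -` A p \<inter> space M))" .
    qed
    show "(case p of (l, k) \<Rightarrow> \<lambda>w. Z l k (Y l w)) \<in> borel_measurable M" if "p \<in> S \<times> T" for p
      using that measurable_compose[OF Y Z] by auto
    show "sets borel = sigma_sets (space borel) (sets (borel::'c measure))"
      by (rule sets.sigma_sets_eq[symmetric])
    show "Int_stable (sets (borel::'c measure))" by (rule sets.Int_stable)
    show "sets (borel::'c measure) \<subseteq> Pow (space borel)" by (rule sets.space_closed)
    show "S \<times> T \<noteq> {}" "finite (S \<times> T)" using False fin by auto
  qed simp_all
qed

section \<open>Sigma-algebras generated by blocks of an independent family\<close>

definition generated_algebra :: "'w measure \<Rightarrow> ('i \<Rightarrow> 'w \<Rightarrow> real) \<Rightarrow> 'i set \<Rightarrow> 'w measure" where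
  "generated_algebra M Z K = vimage_algebra (space M) (\<lambda>w. \<lambda>i\<in>K. Z i w) (PiM K (\<lambda>_. borel))"

lemma space_generated_algebra [simp]: "space (generated_algebra M Z K) = space M"
  by (simp add: generated_algebra_def)

lemma restrict_in_generated_algebra:
  "(\<lambda>w. \<lambda>i\<in>K. Z i w) \<in> measurable (generated_algebra M Z K) (PiM K (\<lambda>_. borel))"
  unfolding generated_algebra_def by (rule measurable_vimage_algebra1) (auto simp: space_PiM)

lemma measurable_generated_algebra:
  assumes "i \<in> K" shows "Z i \<in> borel_measurable (generated_algebra M Z K)"
proof -
  have "(\<lambda>w. (\<lambda>i\<in>K. Z i w) i) \<in> borel_measurable (generated_algebra M Z K)"
    using measurable_compose[OF restrict_in_generated_algebra measurable_component_singleton[OF assms]] .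
  then show ?thesis using assms by simp
qed

lemma sets_generated_algebra_subset:
  assumes "\<And>i. i \<in> K \<Longrightarrow> Z i \<in> borel_measurable N" "space N = space M"
  shows "sets (generated_algebra M Z K) \<subseteq> sets N"
proof -
  have "(\<lambda>w. \<lambda>i\<in>K. Z i w) \<in> measurable N (PiM K (\<lambda>_. borel))"
    using assms by (intro measurable_restrict) auto
  from measurable_sets[OF this] show ?thesis
    unfolding generated_algebra_def using assms(2)
    by (subst sets_vimage_algebra2) (auto simp: space_PiM)
qed

lemma generated_algebra_mono:
  assumes "f \<in> measurable (generated_algebra M Z K) N" "K \<subseteq> K'"
  shows "f \<in> measurable (generated_algebra M Z K') N"
proof -
  have "sets (generated_algebra M Z K) \<subseteq> sets (generated_algebra M Z K')"
    using assms(2) by (intro sets_generated_algebra_subset) (auto intro: measurable_generated_algebra)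
  then show ?thesis using assms(1) by (auto simp: measurable_def)
qed

lemma (in prob_space) generated_algebra_rv:
  assumes "f \<in> measurable (generated_algebra M Z K) N" "\<And>i. i \<in> K \<Longrightarrow> random_variable borel (Z i)"
  shows "random_variable N f"
proof -
  have "sets (generated_algebra M Z K) \<subseteq> sets M"
    using assms(2) by (intro sets_generated_algebra_subset) auto
  then show ?thesis using assms(1) by (auto simp: measurable_def)
qed

text \<open>Disjoint blocks of an independent family generate independent sigma-algebras, and the
  sigma-algebras of \<open>f\<close> and \<open>g\<close> lie inside those. The preimage form of
  \<open>generated_algebra\<close> matches \<open>indep_var_restrict\<close>, so measurability of
  \<open>f\<close> and \<open>g\<close> replaces an explicit formula in the
  \<open>Z i\<close>.\<close>

lemma (in prob_space) indep_var_generated_algebra: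
  assumes ind: "indep_vars (\<lambda>_. borel) Z S" and K: "K \<inter> K' = {}" "K \<subseteq> S" "K' \<subseteq> S"
    and f: "f \<in> measurable (generated_algebra M Z K) N"
    and g: "g \<in> measurable (generated_algebra M Z K') N'"
  shows "indep_var N f N' g"
proof -
  have Z: "random_variable borel (Z i)" if "i \<in> S" for i
    using ind that by (auto simp: indep_vars_def)
  have sets: "sigma_sets (space M) {(\<lambda>w. \<lambda>i\<in>A. Z i w) -` B \<inter> space M | B. B \<in> sets (PiM A (\<lambda>_. borel))}
      = sets (generated_algebra M Z A)" for A
    unfolding generated_algebra_def sets_vimage_algebra ..
  have "indep_set (sets (generated_algebra M Z K)) (sets (generated_algebra M Z K'))"
    using indep_var_restrict[OF ind K] unfolding indep_var_eq sets by blast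
  then show ?thesis
    unfolding indep_var_eq
  proof (intro conjI)
    assume *: "indep_set (sets (generated_algebra M Z K)) (sets (generated_algebra M Z K'))"
    have 1: "sigma_sets (space M) {h -` A \<inter> space M | A. A \<in> sets N''} \<subseteq> sets (generated_algebra M Z A)"
      if "h \<in> measurable (generated_algebra M Z A) N''" for h A and N'' :: "'x measure"
      using measurable_sets[OF that]
      by (intro sets.sigma_sets_subset[of _ "generated_algebra M Z A", simplified]) auto
    show "indep_set (sigma_sets (space M) {f -` A \<inter> space M |A. A \<in> sets N})
        (sigma_sets (space M) {g -` A \<inter> space M |A. A \<in> sets N'})"
      using * 1[OF f] 1[OF g] unfolding indep_sets2_eq by blast
    show "random_variable N f" "random_variable N' g"
      using generated_algebra_rv[OF f] generated_algebra_rv[OF g] Z K by auto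
  qed
qed

lemma (in prob_space) expectation_mult_generated_algebra:
  fixes f g :: "'a \<Rightarrow> real"
  assumes "indep_vars (\<lambda>_. borel) Z S" "K \<inter> K' = {}" "K \<subseteq> S" "K' \<subseteq> S"
    and "f \<in> borel_measurable (generated_algebra M Z K)"
    and "g \<in> borel_measurable (generated_algebra M Z K')"
    and "integrable M f" "integrable M g"
  shows "integrable M (\<lambda>w. f w * g w)" "expectation (\<lambda>w. f w * g w) = expectation f * expectation g"
  using indep_var_integrable[OF indep_var_generated_algebra[OF assms(1-6)] assms(7,8)]
    indep_var_lebesgue_integral[OF indep_var_generated_algebra[OF assms(1-6)] assms(7,8)] by auto

section \<open>Second moments of Gaussian variables and of orthogonal sums\<close>

lemma (in prob_space) centred_gaussian_moments:
  assumes "centred_gaussian M X v" "v > 0"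
  shows "integrable M X" "expectation X = 0" "integrable M (\<lambda>w. (X w)\<^sup>2)"
    "expectation (\<lambda>w. (X w)\<^sup>2) = v"
proof -
  have D: "distributed M lborel X (normal_density 0 (sqrt v))"
    using assms by (auto simp: centred_gaussian_def)
  show "integrable M X"
    using assms(2) by (intro distributed_integrable_var[OF D] integrable_normal_moment_nz_1) auto
  show 0: "expectation X = 0"
    using assms(2) by (intro normal_distributed_expectation[OF _ D]) auto
  show "integrable M (\<lambda>w. (X w)\<^sup>2)"
    using distributed_integrable[OF D, of "\<lambda>x. x\<^sup>2"] integrable_normal_moment[of "sqrt v" 0 2] assms(2)
    by auto
  show "expectation (\<lambda>w. (X w)\<^sup>2) = v"
    using normal_distributed_variance[OF _ D] assms(2) 0 by auto
qed

lemma square_integrable_mult: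
  fixes f g :: "'a \<Rightarrow> real"
  assumes [measurable]: "f \<in> borel_measurable M" "g \<in> borel_measurable M"
    and "integrable M (\<lambda>w. (f w)\<^sup>2)" "integrable M (\<lambda>w. (g w)\<^sup>2)"
  shows "integrable M (\<lambda>w. f w * g w)"
proof (rule Bochner_Integration.integrable_bound)
  show "integrable M (\<lambda>w. (f w)\<^sup>2 + (g w)\<^sup>2)" using assms by auto
  show "AE w in M. norm (f w * g w) \<le> norm ((f w)\<^sup>2 + (g w)\<^sup>2)"
  proof (rule AE_I2)
    fix w
    have "2 * \<bar>f w * g w\<bar> \<le> (f w)\<^sup>2 + (g w)\<^sup>2"
      using sum_squares_bound[of "\<bar>f w\<bar>" "\<bar>g w\<bar>"] by (simp add: abs_mult)
    then show "norm (f w * g w) \<le> norm ((f w)\<^sup>2 + (g w)\<^sup>2)" by simp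
  qed
qed simp

lemma square_integrable_sum:
  fixes f :: "'i \<Rightarrow> 'a \<Rightarrow> real"
  assumes "\<And>e. e \<in> E \<Longrightarrow> f e \<in> borel_measurable M"
    and "\<And>e. e \<in> E \<Longrightarrow> integrable M (\<lambda>w. (f e w)\<^sup>2)"
  shows "integrable M (\<lambda>w. (\<Sum>e\<in>E. f e w)\<^sup>2)"
  unfolding power2_eq_square sum_product using assms
  by (intro Bochner_Integration.integrable_sum square_integrable_mult) auto

text \<open>In the expanded square the linear part vanishes because the means are zero, and the
  off-diagonal part by orthogonality. Later \<open>c\<close> is the deterministic initial part and
  \<open>r e\<close> a resolvent weight.\<close>

lemma (in prob_space) expectation_square_orthogonal_sum:
  fixes Y :: "'i \<Rightarrow> 'a \<Rightarrow> real"
  assumes fin: "finite E"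
    and Y: "\<And>e. e \<in> E \<Longrightarrow> Y e \<in> borel_measurable M"
    and int2: "\<And>e. e \<in> E \<Longrightarrow> integrable M (\<lambda>w. (Y e w)\<^sup>2)"
    and mean: "\<And>e. e \<in> E \<Longrightarrow> expectation (Y e) = 0"
    and orth: "\<And>e f. e \<in> E \<Longrightarrow> f \<in> E \<Longrightarrow> e \<noteq> f \<Longrightarrow> expectation (\<lambda>w. Y e w * Y f w) = 0"
  shows "expectation (\<lambda>w. (c + (\<Sum>e\<in>E. r e * Y e w))\<^sup>2)
       = c\<^sup>2 + (\<Sum>e\<in>E. (r e)\<^sup>2 * expectation (\<lambda>w. (Y e w)\<^sup>2))"
proof -
  have int: "integrable M (Y e)" if "e \<in> E" for e
    using square_integrable_imp_integrable[OF Y int2] that by simp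
  have intp: "integrable M (\<lambda>w. Y e w * Y f w)" if "e \<in> E" "f \<in> E" for e f
    using that Y int2 by (intro square_integrable_mult) auto
  have "(c + (\<Sum>e\<in>E. r e * Y e w))\<^sup>2
      = c\<^sup>2 + (\<Sum>e\<in>E. 2 * c * r e * Y e w) + (\<Sum>e\<in>E. \<Sum>f\<in>E. r e * r f * (Y e w * Y f w))" for w
    unfolding power2_sum power2_eq_square sum_product
    by (simp add: sum_distrib_left sum_distrib_right algebra_simps)
  then have "expectation (\<lambda>w. (c + (\<Sum>e\<in>E. r e * Y e w))\<^sup>2)
      = c\<^sup>2 + (\<Sum>e\<in>E. 2 * c * r e * expectation (Y e))
        + (\<Sum>e\<in>E. \<Sum>f\<in>E. r e * r f * expectation (\<lambda>w. Y e w * Y f w))"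
    using int intp by (simp add: prob_space)
  also have "(\<Sum>e\<in>E. 2 * c * r e * expectation (Y e)) = 0"
    using mean by simp
  also have "(\<Sum>e\<in>E. \<Sum>f\<in>E. r e * r f * expectation (\<lambda>w. Y e w * Y f w))
      = (\<Sum>e\<in>E. (r e)\<^sup>2 * expectation (\<lambda>w. (Y e w)\<^sup>2))"
  proof (rule sum.cong[OF refl])
    fix e assume e: "e \<in> E"
    have "(\<Sum>f\<in>E. r e * r f * expectation (\<lambda>w. Y e w * Y f w))
        = (\<Sum>f\<in>{e}. r e * r f * expectation (\<lambda>w. Y e w * Y f w))"
      using e fin orth by (intro sum.mono_neutral_right) auto
    then show "(\<Sum>f\<in>E. r e * r f * expectation (\<lambda>w. Y e w * Y f w))
        = (r e)\<^sup>2 * expectation (\<lambda>w. (Y e w)\<^sup>2)"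
      by (simp add: power2_eq_square)
  qed
  finally show ?thesis by simp
qed

text \<open>With \<open>P \<eta>\<close> the product,
  \<open>x \<eta> * P \<eta> = P (\<eta> - 1) - P \<eta>\<close> whenever
  \<open>s < \<tau> \<eta>\<close>, and \<open>(P \<eta>)^2 \<le> P \<eta>\<close>. Indices with
  \<open>\<tau> \<eta> \<le> s\<close> leave \<open>P\<close> unchanged, so the bound telescopes
  over all of \<open>{1..m}\<close> to \<open>P 0 - P m\<close>.\<close>

lemma resolvent_weights_sum_le_1:
  fixes x \<tau> :: "nat \<Rightarrow> real"
  assumes x: "\<And>k. 1 \<le> k \<Longrightarrow> k \<le> m \<Longrightarrow> 0 \<le> x k"
  shows "(\<Sum>\<eta>\<in>{\<eta>\<in>{1..m}. s < \<tau> \<eta>}. x \<eta> * (\<Prod>k\<in>{k\<in>{1..\<eta>}. s < \<tau> k}. 1 / (1 + x k))\<^sup>2) \<le> 1"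
proof -
  define P where "P \<eta> = (\<Prod>k\<in>{k\<in>{1..\<eta>}. s < \<tau> k}. 1 / (1 + x k))" for \<eta>
  have P: "0 \<le> P \<eta> \<and> P \<eta> \<le> 1" if "\<eta> \<le> m" for \<eta>
    unfolding P_def using that x by (intro conjI prod_nonneg prod_le_1) (auto simp: divide_le_eq_1)
  have "(\<Sum>\<eta>\<in>{\<eta>\<in>{1..m}. s < \<tau> \<eta>}. x \<eta> * (P \<eta>)\<^sup>2) = (\<Sum>\<eta>\<in>{1..m}. if s < \<tau> \<eta> then x \<eta> * (P \<eta>)\<^sup>2 else 0)"
    by (rule sum.inter_filter) simp
  also have "\<dots> \<le> (\<Sum>\<eta>\<in>{1..m}. P (\<eta> - 1) - P \<eta>)"
  proof (rule sum_mono)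
    fix \<eta> assume \<eta>: "\<eta> \<in> {1..m}"
    then obtain k where k: "\<eta> = Suc k" by (cases \<eta>) auto
    show "(if s < \<tau> \<eta> then x \<eta> * (P \<eta>)\<^sup>2 else 0) \<le> P (\<eta> - 1) - P \<eta>"
    proof (cases "s < \<tau> \<eta>")
      case True
      then have "{i\<in>{1..\<eta>}. s < \<tau> i} = insert \<eta> {i\<in>{1..k}. s < \<tau> i}"
        using k by auto
      then have "P \<eta> = 1 / (1 + x \<eta>) * P k"
        unfolding P_def using k by simp
      moreover have x0: "0 \<le> x \<eta>" using x \<eta> by auto
      ultimately have "x \<eta> * P \<eta> = P k - P \<eta>"
        by (simp add: field_simps)
      moreover have "(P \<eta>)\<^sup>2 \<le> P \<eta>"
        using P[of \<eta>] \<eta> by (simp add: power2_eq_square mult_left_le)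
      then have "x \<eta> * (P \<eta>)\<^sup>2 \<le> x \<eta> * P \<eta>"
        using x0 by (rule mult_left_mono)
      ultimately show ?thesis using True k by simp
    next
      case False
      then have "{i\<in>{1..\<eta>}. s < \<tau> i} = {i\<in>{1..k}. s < \<tau> i}"
        using k by (auto simp: le_Suc_eq)
      then show ?thesis using False k by (simp add: P_def)
    qed
  qed
  also have "\<dots> = P 0 - P m"
    by (induction m) (auto simp: algebra_simps)
  also have "\<dots> \<le> 1"
    using P[of m] by (simp add: P_def)
  finally show ?thesis by (simp add: P_def)
qed


section \<open>The time grid and the scheme\<close>

lemma grid_subset: "grid L n \<subseteq> {0..1}"
  by (auto simp: grid_def divide_le_eq_1)

lemma zero_in_grid: "1 \<le> L \<Longrightarrow> 0 \<in> grid L n"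
  unfolding grid_def by force

text \<open>\<open>num_steps\<close> uses truncated subtraction; the point 0 keeps the grid
  nonempty, so nothing is lost.\<close>

lemma Suc_num_steps: "1 \<le> L \<Longrightarrow> card (grid L n) = Suc (num_steps L n)"
  using zero_in_grid[of L n] finite_grid[of L n] unfolding num_steps_def
  by (metis Suc_diff_1 card_gt_0_iff empty_iff)

lemma tau_strict_mono:
  assumes "1 \<le> L" "a < b" "b \<le> num_steps L n"
  shows "tau L n a < tau L n b"
proof -
  have 1: "sorted_wrt (<) (sorted_list_of_set (grid L n))" by simp
  have 2: "b < length (sorted_list_of_set (grid L n))"
    using assms Suc_num_steps[of L n] by simp
  show ?thesis
    unfolding tau_def by (rule sorted_wrt_nth_less[OF 1 assms(2) 2])
qed

lemma tau_mono:
  assumes "1 \<le> L" "a \<le> b" "b \<le> num_steps L n"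
  shows "tau L n a \<le> tau L n b"
  using tau_strict_mono[of L a b n] assms by (cases "a = b") auto

lemma tau_less_iff:
  assumes "1 \<le> L" "a \<le> num_steps L n" "b \<le> num_steps L n"
  shows "tau L n a < tau L n b \<longleftrightarrow> a < b"
  using tau_strict_mono[of L a b n] tau_mono[of L b a n] assms by (meson linorder_not_less)

lemma tau_le_iff:
  assumes "1 \<le> L" "a \<le> num_steps L n" "b \<le> num_steps L n"
  shows "tau L n a \<le> tau L n b \<longleftrightarrow> a \<le> b"
  using tau_less_iff[of L b n a] assms by (meson linorder_not_less)

lemma grid_eq_tau:
  assumes "1 \<le> L"
  shows "grid L n = tau L n ` {..num_steps L n}"
proof -
  have "grid L n = set (sorted_list_of_set (grid L n))"
    by (simp add: finite_grid)
  also have "\<dots> = tau L n ` {..<card (grid L n)}"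
    unfolding set_conv_nth tau_def by auto
  finally show ?thesis
    by (simp add: Suc_num_steps[OF assms] lessThan_Suc_atMost)
qed

lemma tau_in_grid: "1 \<le> L \<Longrightarrow> k \<le> num_steps L n \<Longrightarrow> tau L n k \<in> grid L n"
  using grid_eq_tau by blast

lemma tau_bounds: "1 \<le> L \<Longrightarrow> k \<le> num_steps L n \<Longrightarrow> tau L n k \<in> {0..1}"
  using tau_in_grid grid_subset by blast

lemma tau_pos:
  assumes "1 \<le> L" "1 \<le> k" "k \<le> num_steps L n"
  shows "0 < tau L n k"
  using tau_strict_mono[of L 0 k n] tau_bounds[of L 0 n] assms by auto

text \<open>The facts that the moment argument uses. The Lipschitz bound is stated mode by mode; it
  serves to make second moments finite, and \<open>C\<close> does not enter the final estimate.
  \<open>B_zero\<close> makes the modes beyond \<open>L\<close> vanish after projection.\<close>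

locale euler_scheme = prob_space M
  for M :: "'w measure" +
  fixes I :: "nat set" and h :: "nat \<Rightarrow> 'h::{real_inner, second_countable_topology}"
    and lam q :: "nat \<Rightarrow> real"
    and B :: "real \<Rightarrow> 'h \<Rightarrow> 'h \<Rightarrow> 'h" and beta :: "nat \<Rightarrow> real \<Rightarrow> 'w \<Rightarrow> real"
    and xi :: 'h and J L :: nat and C :: real and n :: "nat \<Rightarrow> nat"
  assumes orthonormal: "j \<in> I \<Longrightarrow> k \<in> I \<Longrightarrow> inner (h j) (h k) = (if j = k then 1 else 0)"
    and lam_pos: "j \<in> I \<Longrightarrow> 0 < lam j"
    and lipschitz: "t \<in> {0..1} \<Longrightarrow> l \<in> I \<Longrightarrow>
      norm (B t u (sqrt (q l) *\<^sub>R h l) - B t v (sqrt (q l) *\<^sub>R h l)) \<le> C * norm (u - v)"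
    and B_zero: "t \<in> {0..1} \<Longrightarrow> B t u 0 = 0"
    and brownian: "l \<in> I \<Longrightarrow> standard_brownian_motion M (beta l)"
    and indep_modes: "indep_vars (\<lambda>_. PiM {0..1} (\<lambda>_. borel)) (\<lambda>l w. \<lambda>t\<in>{0..1}. beta l t w) I"
    and L_pos: "1 \<le> L"
    and n_pos: "l \<in> {1..L} \<Longrightarrow> 1 \<le> n l"
begin

abbreviation "N \<equiv> num_steps L n"
abbreviation "\<tau> \<equiv> tau L n"
abbreviation "modes \<equiv> {1..L} \<inter> I"
abbreviation "X \<equiv> X_hat I h lam q B beta xi J L n"
abbreviation "R \<equiv> resolvent_prod lam L n"

text \<open>A pair \<open>(l, i)\<close> stands for one noise increment: mode \<open>l\<close> over
  the \<open>i\<close>-th interval of its own grid. Flattening the double sum lets orthogonality be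
  stated for pairs of steps.\<close>

definition "steps = (SIGMA l:modes. {1..n l})"
definition start :: "nat \<times> nat \<Rightarrow> real" where "start e = real (snd e - 1) / real (n (fst e))"
definition stop :: "nat \<times> nat \<Rightarrow> real" where "stop e = real (snd e) / real (n (fst e))"
definition "incr e w = beta (fst e) (stop e) w - beta (fst e) (start e) w"
definition "diffusion j e w =
  inner (B (start e) (X (start e) w) (sqrt (q (fst e)) *\<^sub>R h (fst e))) (h j)"
definition "X_comp j t w = R j 0 t * inner xi (h j)
  + (\<Sum>e\<in>{e\<in>steps. stop e \<le> t}. R j (start e) t * (diffusion j e w * incr e w))"

text \<open>The modes have different grids. Cutting every increment at all points of the joint grid
  yields one family indexed by \<open>modes \<times> {..<N}\<close>, on which pasts and increments
  of all modes can be compared.\<close>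

definition "fine_incr = (\<lambda>(l, k) w. beta l (\<tau> (Suc k)) w - beta l (\<tau> k) w)"
definition "fine_steps s t = {k. k < N \<and> s < \<tau> (Suc k) \<and> \<tau> (Suc k) \<le> t}"
text \<open>\<open>G (past t)\<close> is the discrete filtration to which the scheme turns out to be
  adapted.\<close>

definition "past t = modes \<times> fine_steps 0 t"

abbreviation "G \<equiv> generated_algebra M fine_incr"

lemma finite_steps: "finite steps"
  by (simp add: steps_def)

lemma steps_iff: "(l, i) \<in> steps \<longleftrightarrow> l \<in> modes \<and> 1 \<le> i \<and> i \<le> n l"
  by (auto simp: steps_def)

lemma start_lt_stop: "e \<in> steps \<Longrightarrow> start e < stop e"
  by (cases e) (auto simp: steps_iff start_def stop_def intro!: divide_strict_right_mono)

lemma start_in_grid: "e \<in> steps \<Longrightarrow> start e \<in> grid L n"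
  unfolding grid_def start_def
  by (intro UN_I[of "fst e"] image_eqI[of _ _ "snd e - 1"]) (auto simp: steps_def)

lemma stop_in_grid: "e \<in> steps \<Longrightarrow> stop e \<in> grid L n"
  unfolding grid_def stop_def
  by (intro UN_I[of "fst e"] image_eqI[of _ _ "snd e"]) (auto simp: steps_def)

lemma start_bounds: "e \<in> steps \<Longrightarrow> start e \<in> {0..1}"
  using start_in_grid grid_subset by blast

lemma stop_bounds: "e \<in> steps \<Longrightarrow> stop e \<in> {0..1}"
  using stop_in_grid grid_subset by blast

text \<open>One unfolding of the recursion, with the nested sums over \<open>l\<close> and
  \<open>i\<close> merged. Inside \<open>X_comp j t\<close> the scheme occurs only at the earlier
  times \<open>start e\<close>.\<close>

lemma X_eq: "X t w = (\<Sum>j\<in>{1..J} \<inter> I. X_comp j t w *\<^sub>R h j)"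
proof -
  have "{e \<in> steps. stop e \<le> t} = (SIGMA l:modes. {i\<in>{1..n l}. real i / real (n l) \<le> t})"
    by (auto simp: steps_def stop_def)
  moreover have "(\<Sum>l\<in>modes. \<Sum>i\<in>{i\<in>{1..n l}. real i / real (n l) \<le> t}. f l i)
      = (\<Sum>e\<in>(SIGMA l:modes. {i\<in>{1..n l}. real i / real (n l) \<le> t}). f (fst e) (snd e))"
    for f :: "nat \<Rightarrow> nat \<Rightarrow> real"
    by (subst sum.Sigma) (auto simp: case_prod_unfold)
  ultimately show ?thesis
    by (subst X_hat.simps)
      (simp only: X_comp_def diffusion_def incr_def start_def stop_def mult.assoc)
qed

lemma inner_basis_sum:
  assumes "k \<in> I" "finite S" "S \<subseteq> I"
  shows "inner (\<Sum>j\<in>S. c j *\<^sub>R h j) (h k) = (if k \<in> S then c k else 0)"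
proof -
  have "inner (\<Sum>j\<in>S. c j *\<^sub>R h j) (h k) = (\<Sum>j\<in>S. if j = k then c j else 0)"
    unfolding inner_sum_left using assms by (intro sum.cong) (auto simp: orthonormal)
  then show ?thesis using assms by (simp add: sum.delta')
qed

text \<open>Coefficients off the finite index set vanish, so the infinite sum is a finite one and
  its convergence is automatic.\<close>

lemma norm_pow_basis_sum:
  "(norm_pow I h lam r (\<Sum>j\<in>{1..J} \<inter> I. c j *\<^sub>R h j))\<^sup>2
    = (\<Sum>j\<in>{1..J} \<inter> I. lam j powr (2 * r) * (c j)\<^sup>2)"
proof -
  have "(\<Sum>\<^sub>\<infinity>k\<in>I. lam k powr (2 * r) * (inner (\<Sum>j\<in>{1..J} \<inter> I. c j *\<^sub>R h j) (h k))\<^sup>2)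
      = (\<Sum>\<^sub>\<infinity>k\<in>{1..J} \<inter> I. lam k powr (2 * r) * (c k)\<^sup>2)"
    by (intro infsum_cong_neutral) (auto simp: inner_basis_sum)
  then show ?thesis
    by (simp add: norm_pow_def sum_nonneg)
qed

lemma norm_pow_eig_proj:
  "(norm_pow I h lam r (eig_proj I h J x))\<^sup>2
    = (\<Sum>j\<in>{1..J} \<inter> I. lam j powr (2 * r) * (inner x (h j))\<^sup>2)"
  unfolding eig_proj_def by (rule norm_pow_basis_sum)

lemma eig_proj_basis:
  assumes "l \<in> I"
  shows "eig_proj I h L (c *\<^sub>R h l) = (if l \<in> modes then c *\<^sub>R h l else 0)"
proof -
  have "eig_proj I h L (c *\<^sub>R h l) = (\<Sum>j\<in>modes. if j = l then c *\<^sub>R h l else 0)"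
    unfolding eig_proj_def using assms by (intro sum.cong) (auto simp: orthonormal)
  then show ?thesis by (simp add: sum.delta')
qed

text \<open>Independence across modes is given for whole paths, independence in time for the
  increments of one path; \<open>indep_vars_Times\<close> joins the two, with the paths as
  rows.\<close>

lemma indep_fine_incr: "indep_vars (\<lambda>_. borel) fine_incr (modes \<times> {..<N})"
proof -
  \<comment> \<open>\<open>D l k\<close> reads the increment over cell \<open>k\<close> off a path,
    which makes it a measurable function of the path variable.\<close>
  define D :: "nat \<Rightarrow> nat \<Rightarrow> (real \<Rightarrow> real) \<Rightarrow> real" where "D l k = (\<lambda>y. y (\<tau> (Suc k)) - y (\<tau> k))" for l k
  have \<tau>: "\<tau> (Suc k) \<in> {0..1}" "\<tau> k \<in> {0..1}" if "k < N" for k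
    using tau_bounds[OF L_pos, of "Suc k" n] tau_bounds[OF L_pos, of k n] that by auto
  have "indep_vars (\<lambda>_. borel) (\<lambda>(l, k) w. D l k (\<lambda>t\<in>{0..1}. beta l t w)) (modes \<times> {..<N})"
  proof (rule indep_vars_Times[where Z=D and Y="\<lambda>l w. \<lambda>t\<in>{0..1}. beta l t w"
        and N="\<lambda>_. PiM {0..1} (\<lambda>_. borel)"])
    show "indep_vars (\<lambda>_. PiM {0..1} (\<lambda>_. borel)) (\<lambda>l w. \<lambda>t\<in>{0..1}. beta l t w) modes"
      by (rule indep_vars_subset[OF indep_modes]) auto
    show "D l k \<in> borel_measurable (PiM {0..1} (\<lambda>_. borel))" if "k \<in> {..<N}" for l k
      unfolding D_def using \<tau>[of k] that by (intro borel_measurable_diff measurable_component_singleton)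
        auto
    show "indep_vars (\<lambda>_. borel) (\<lambda>k w. D l k (\<lambda>t\<in>{0..1}. beta l t w)) {..<N}" if "l \<in> modes" for l
    proof -
      have "independent_increments M (beta l)"
        using that brownian by (auto simp: standard_brownian_motion_def)
      then have "indep_vars (\<lambda>_. borel) (\<lambda>k w. beta l (\<tau> (Suc k)) w - beta l (\<tau> k) w) {..<N}"
        unfolding independent_increments_def
        using tau_bounds[OF L_pos] tau_mono[OF L_pos] by auto
      then show ?thesis
        using \<tau> by (subst indep_vars_cong[OF refl _ refl]) (auto simp: D_def)
    qed
  qed auto
  then show ?thesis
    using \<tau> by (subst indep_vars_cong[OF refl _ refl]) (auto simp: D_def fine_incr_def)
qed

lemma fine_incr_measurable: "p \<in> modes \<times> {..<N} \<Longrightarrow> fine_incr p \<in> borel_measurable M"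
  using indep_fine_incr by (auto simp: indep_vars_def)

lemma G_measurable_M:
  assumes "f \<in> measurable (G K) S" "K \<subseteq> modes \<times> {..<N}"
  shows "f \<in> measurable M S"
  using generated_algebra_rv[OF assms(1)] fine_incr_measurable assms(2) by blast

lemma fine_steps_subset: "fine_steps s t \<subseteq> {..<N}"
  by (auto simp: fine_steps_def)

lemma past_subset: "past t \<subseteq> modes \<times> {..<N}"
  using fine_steps_subset by (auto simp: past_def)

text \<open>Both end points lie in the joint grid, so the increment telescopes over the cells in
  between.\<close>

lemma incr_eq_sum:
  assumes "e \<in> steps"
  shows "incr e w = (\<Sum>k\<in>fine_steps (start e) (stop e). fine_incr (fst e, k) w)"
proof -
  obtain a b where ab: "start e = \<tau> a" "stop e = \<tau> b" "a \<le> N" "b \<le> N"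
    using start_in_grid[OF assms] stop_in_grid[OF assms] grid_eq_tau[OF L_pos] by auto
  then have "a < b" using start_lt_stop[OF assms] tau_less_iff[OF L_pos] by simp
  \<comment> \<open>Cell \<open>k\<close> runs from \<open>\<tau> k\<close> to
    \<open>\<tau> (Suc k)\<close> and is located by its right end; hence \<open>a\<close> is
    included and \<open>b\<close> is not.\<close>
  have "fine_steps (start e) (stop e) = {a..<b}"
    using ab tau_less_iff[OF L_pos] tau_le_iff[OF L_pos]
    by (auto simp: fine_steps_def Suc_le_eq less_Suc_eq_le)
  moreover have "(\<Sum>k\<in>{a..<b}. fine_incr (fst e, k) w) = beta (fst e) (\<tau> b) w - beta (fst e) (\<tau> a) w"
    using sum_Suc_diff'[of a b "\<lambda>k. beta (fst e) (\<tau> k) w"] \<open>a < b\<close> by (simp add: fine_incr_def)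
  ultimately show ?thesis using ab by (simp add: incr_def)
qed

lemma incr_measurable_G:
  assumes "e \<in> steps" "{fst e} \<times> fine_steps (start e) (stop e) \<subseteq> K"
  shows "incr e \<in> borel_measurable (G K)"
  unfolding incr_eq_sum[OF assms(1)] using assms(2)
  by (intro borel_measurable_sum measurable_generated_algebra) auto

lemma step_in_past:
  assumes "e \<in> steps" "stop e \<le> t"
  shows "{fst e} \<times> fine_steps (start e) (stop e) \<subseteq> past t"
  using assms start_bounds[OF assms(1)]
  by (cases e) (auto simp: past_def fine_steps_def steps_iff)

lemma incr_gaussian:
  assumes "e \<in> steps"
  shows "integrable M (incr e)" "expectation (incr e) = 0" "integrable M (\<lambda>w. (incr e w)\<^sup>2)"
    "expectation (\<lambda>w. (incr e w)\<^sup>2) = stop e - start e"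
proof -
  have "fst e \<in> I" using assms by (cases e) (auto simp: steps_iff)
  then have "centred_gaussian M (incr e) (stop e - start e)"
    using brownian start_bounds[OF assms] stop_bounds[OF assms] start_lt_stop[OF assms]
    unfolding standard_brownian_motion_def incr_def by auto
  from centred_gaussian_moments[OF this] start_lt_stop[OF assms]
  show "integrable M (incr e)" "expectation (incr e) = 0" "integrable M (\<lambda>w. (incr e w)\<^sup>2)"
    "expectation (\<lambda>w. (incr e w)\<^sup>2) = stop e - start e" by auto
qed

end


section \<open>Moments of the scheme and the smoothing bound\<close>

context euler_scheme
begin

lemma norm_basis_sum:
  "(norm (\<Sum>j\<in>{1..J} \<inter> I. c j *\<^sub>R h j))\<^sup>2 = (\<Sum>j\<in>{1..J} \<inter> I. (c j)\<^sup>2)"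
  unfolding power2_norm_eq_inner inner_sum_right
  by (intro sum.cong) (auto simp: inner_basis_sum power2_eq_square)

text \<open>For fixed time and mode, Lipschitz continuity makes the coefficient a Borel function of
  the state and gives it linear growth, so measurability and square integrability pass from
  \<open>X (start e)\<close> to the coefficient.\<close>

lemma diffusion_square_integrable:
  assumes e: "e \<in> steps"
    and X: "X (start e) \<in> borel_measurable (G (past (start e)))"
    and int: "integrable M (\<lambda>w. (norm (X (start e) w))\<^sup>2)"
  shows "diffusion j e \<in> borel_measurable (G (past (start e)))"
    and "integrable M (\<lambda>w. (diffusion j e w)\<^sup>2)"
proof -
  define f where "f u = B (start e) u (sqrt (q (fst e)) *\<^sub>R h (fst e))" for u
  have lI: "fst e \<in> I" using e by (cases e) (auto simp: steps_iff)
  \<comment> \<open>The sign of \<open>C\<close> is not fixed, hence the absolute value.\<close>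
  have lip: "norm (f u - f v) \<le> \<bar>C\<bar> * norm (u - v)" for u v
    using lipschitz[OF start_bounds[OF e] lI, of u v] mult_right_mono[OF abs_ge_self[of C] norm_ge_zero[of "u - v"]]
    unfolding f_def by linarith
  then have "\<bar>C\<bar>-lipschitz_on UNIV f"
    by (intro lipschitz_onI) (auto simp: dist_norm)
  then have "continuous_on UNIV (\<lambda>u. inner (f u) (h j))"
    by (intro continuous_intros lipschitz_on_continuous_on)
  then have "(\<lambda>u. inner (f u) (h j)) \<in> borel_measurable borel"
    by (rule borel_measurable_continuous_onI)
  from measurable_compose[OF X this]
  show meas: "diffusion j e \<in> borel_measurable (G (past (start e)))"
    by (simp add: diffusion_def[abs_def] f_def)
  have [measurable]: "diffusion j e \<in> borel_measurable M"
    by (rule G_measurable_M[OF meas past_subset])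
  show "integrable M (\<lambda>w. (diffusion j e w)\<^sup>2)"
  proof (rule Bochner_Integration.integrable_bound)
    \<comment> \<open>The dominating function comes from Cauchy-Schwarz and
      \<open>(a + b)^2 \<le> 2 * a^2 + 2 * b^2\<close>, applied to the linear growth bound.\<close>
    show "integrable M (\<lambda>w. (norm (h j))\<^sup>2 * (2 * (norm (f 0))\<^sup>2 + 2 * C\<^sup>2 * (norm (X (start e) w))\<^sup>2))"
      using int by auto
    show "AE w in M. norm ((diffusion j e w)\<^sup>2)
        \<le> norm ((norm (h j))\<^sup>2 * (2 * (norm (f 0))\<^sup>2 + 2 * C\<^sup>2 * (norm (X (start e) w))\<^sup>2))"
    proof (rule AE_I2)
      fix w
      let ?x = "X (start e) w"
      have "norm (f ?x) \<le> norm (f 0) + \<bar>C\<bar> * norm ?x"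
        using lip[of ?x 0] norm_triangle_ineq2[of "f ?x" "f 0"] by simp
      then have "(norm (f ?x))\<^sup>2 \<le> (norm (f 0) + \<bar>C\<bar> * norm ?x)\<^sup>2"
        by (intro power_mono) auto
      also have "\<dots> \<le> 2 * (norm (f 0))\<^sup>2 + 2 * C\<^sup>2 * (norm ?x)\<^sup>2"
        using sum_squares_bound[of "norm (f 0)" "\<bar>C\<bar> * norm ?x"]
        by (simp add: power2_sum power_mult_distrib)
      finally have 1: "(norm (f ?x))\<^sup>2 \<le> 2 * (norm (f 0))\<^sup>2 + 2 * C\<^sup>2 * (norm ?x)\<^sup>2" .
      have "(inner (f ?x) (h j))\<^sup>2 \<le> (norm (h j))\<^sup>2 * (norm (f ?x))\<^sup>2"
        using power_mono[OF Cauchy_Schwarz_ineq2[of "f ?x" "h j"], of 2]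
        by (simp add: power_mult_distrib mult.commute)
      also have "\<dots> \<le> (norm (h j))\<^sup>2 * (2 * (norm (f 0))\<^sup>2 + 2 * C\<^sup>2 * (norm ?x)\<^sup>2)"
        using 1 by (intro mult_left_mono) auto
      finally show "norm ((diffusion j e w)\<^sup>2)
          \<le> norm ((norm (h j))\<^sup>2 * (2 * (norm (f 0))\<^sup>2 + 2 * C\<^sup>2 * (norm ?x)\<^sup>2))"
        by (simp add: diffusion_def f_def)
    qed
  qed simp
qed

lemma past_mono: "s \<le> t \<Longrightarrow> past s \<subseteq> past t"
  by (auto simp: past_def fine_steps_def)

lemma own_steps_subset: "e \<in> steps \<Longrightarrow> {fst e} \<times> fine_steps (start e) (stop e) \<subseteq> modes \<times> {..<N}"
  using fine_steps_subset by (cases e) (auto simp: steps_iff)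

text \<open>The coefficient depends on cells up to \<open>start e\<close>, the increment on later
  cells; so the two factors are independent, and so are their squares. The second identity is the
  Ito isometry for one step.\<close>

lemma noise_square_expectation:
  assumes e: "e \<in> steps"
    and meas: "diffusion j e \<in> borel_measurable (G (past (start e)))"
    and int: "integrable M (\<lambda>w. (diffusion j e w)\<^sup>2)"
  shows "integrable M (\<lambda>w. (diffusion j e w * incr e w)\<^sup>2)"
    and "expectation (\<lambda>w. (diffusion j e w * incr e w)\<^sup>2)
      = expectation (\<lambda>w. (diffusion j e w)\<^sup>2) * (stop e - start e)"
    and "expectation (\<lambda>w. diffusion j e w * incr e w) = 0"
proof -
  note * = expectation_mult_generated_algebra[OF indep_fine_incr _ past_subset own_steps_subset[OF e],
      of "start e"]
  have disj: "past (start e) \<inter> {fst e} \<times> fine_steps (start e) (stop e) = {}"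
    by (auto simp: past_def fine_steps_def)
  have incr: "incr e \<in> borel_measurable (G ({fst e} \<times> fine_steps (start e) (stop e)))"
    using incr_measurable_G[OF e] by blast
  show "integrable M (\<lambda>w. (diffusion j e w * incr e w)\<^sup>2)"
    "expectation (\<lambda>w. (diffusion j e w * incr e w)\<^sup>2)
      = expectation (\<lambda>w. (diffusion j e w)\<^sup>2) * (stop e - start e)"
    using *[OF disj borel_measurable_power[OF meas] borel_measurable_power[OF incr] int
        incr_gaussian(3)[OF e]] incr_gaussian(4)[OF e]
    by (auto simp: power_mult_distrib)
  show "expectation (\<lambda>w. diffusion j e w * incr e w) = 0"
    using *[OF disj meas incr square_integrable_imp_integrable[OF G_measurable_M[OF meas past_subset] int]
        incr_gaussian(1)[OF e]] incr_gaussian(2)[OF e] by simp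
qed

text \<open>Induction on the number of grid points before \<open>t\<close>, the quantity that makes
  the recursion terminate. Both claims go together because the coefficients at earlier times inherit
  both from the scheme.\<close>

lemma X_square_integrable:
  "X t \<in> borel_measurable (G (past t)) \<and> integrable M (\<lambda>w. (norm (X t w))\<^sup>2)"
proof (induction "card {r \<in> grid L n. r < t}" arbitrary: t rule: less_induct)
  case less
  have IH: "X (start e) \<in> borel_measurable (G (past (start e)))"
    "integrable M (\<lambda>w. (norm (X (start e) w))\<^sup>2)" if "e \<in> steps" "stop e \<le> t" for e
  proof -
    have "start e < t" using start_lt_stop[OF that(1)] that(2) by simp
    then have "{r \<in> grid L n. r < start e} \<subset> {r \<in> grid L n. r < t}"
      using start_in_grid[OF that(1)] by auto
    then have "card {r \<in> grid L n. r < start e} < card {r \<in> grid L n. r < t}"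
      by (intro psubset_card_mono) (auto simp: finite_grid)
    from less[OF this] show "X (start e) \<in> borel_measurable (G (past (start e)))"
      "integrable M (\<lambda>w. (norm (X (start e) w))\<^sup>2)" by auto
  qed
  have meas: "(\<lambda>w. diffusion j e w * incr e w) \<in> borel_measurable (G (past t))"
    if "e \<in> steps" "stop e \<le> t" for e j
    using generated_algebra_mono[OF diffusion_square_integrable(1)[OF that(1) IH[OF that]] past_mono, of t]
      start_lt_stop[OF that(1)] that(2) incr_measurable_G[OF that(1) step_in_past[OF that]]
    by (intro borel_measurable_times) auto
  have meas_comp: "X_comp j t \<in> borel_measurable (G (past t))" for j
    unfolding X_comp_def[abs_def]
    by (intro borel_measurable_add borel_measurable_sum borel_measurable_const
        borel_measurable_times[OF borel_measurable_const meas]) auto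
  have int_comp: "integrable M (\<lambda>w. (X_comp j t w)\<^sup>2)" for j
  proof -
    let ?S = "\<lambda>w. \<Sum>e\<in>{e \<in> steps. stop e \<le> t}. R j (start e) t * (diffusion j e w * incr e w)"
    have [measurable]: "?S \<in> borel_measurable M"
      by (intro borel_measurable_sum
          borel_measurable_times[OF borel_measurable_const G_measurable_M[OF meas past_subset]]) auto
    have S2: "integrable M (\<lambda>w. (?S w)\<^sup>2)"
    proof (rule square_integrable_sum)
      fix e assume e: "e \<in> {e \<in> steps. stop e \<le> t}"
      then show "(\<lambda>w. R j (start e) t * (diffusion j e w * incr e w)) \<in> borel_measurable M"
        by (intro borel_measurable_times[OF borel_measurable_const G_measurable_M[OF meas past_subset]]) auto
      have "integrable M (\<lambda>w. (diffusion j e w * incr e w)\<^sup>2)"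
        using e diffusion_square_integrable[OF _ IH] by (intro noise_square_expectation(1)) auto
      then show "integrable M (\<lambda>w. (R j (start e) t * (diffusion j e w * incr e w))\<^sup>2)"
        by (simp add: power_mult_distrib[of "R j (start e) t"])
    qed
    moreover have "integrable M ?S"
      by (rule square_integrable_imp_integrable[OF _ S2]) simp
    ultimately show ?thesis
      unfolding X_comp_def power2_sum by (intro Bochner_Integration.integrable_add) auto
  qed
  have "X t = (\<lambda>w. \<Sum>j\<in>{1..J} \<inter> I. X_comp j t w *\<^sub>R h j)"
    by (rule ext) (rule X_eq)
  moreover have "(\<lambda>w. \<Sum>j\<in>{1..J} \<inter> I. X_comp j t w *\<^sub>R h j) \<in> borel_measurable (G (past t))"
    using meas_comp by (intro borel_measurable_sum borel_measurable_scaleR) auto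
  moreover have "integrable M (\<lambda>w. (norm (X t w))\<^sup>2)"
    unfolding X_eq norm_basis_sum using int_comp by (intro Bochner_Integration.integrable_sum)
  ultimately show ?case by simp
qed

lemma diffusion_measurable: "e \<in> steps \<Longrightarrow> diffusion j e \<in> borel_measurable (G (past (start e)))"
  using diffusion_square_integrable(1) X_square_integrable by blast

lemma diffusion_integrable: "e \<in> steps \<Longrightarrow> integrable M (\<lambda>w. (diffusion j e w)\<^sup>2)"
  using diffusion_square_integrable(2) X_square_integrable by blast

lemmas noise_moments = noise_square_expectation[OF _ diffusion_measurable diffusion_integrable]

lemma noise_measurable_G:
  assumes "e \<in> steps" "past (start e) \<union> {fst e} \<times> fine_steps (start e) (stop e) \<subseteq> K"
  shows "(\<lambda>w. diffusion j e w * incr e w) \<in> borel_measurable (G K)"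
  using generated_algebra_mono[OF diffusion_measurable] incr_measurable_G assms
  by (intro borel_measurable_times) auto

lemma noise_measurable: "e \<in> steps \<Longrightarrow> (\<lambda>w. diffusion j e w * incr e w) \<in> borel_measurable M"
  by (rule G_measurable_M[OF noise_measurable_G[OF _ Un_least[OF past_subset own_steps_subset]] order_refl])

text \<open>The increment of the later step is independent of the three remaining factors: if both steps
  start together, they belong to different modes.\<close>

lemma noise_orthogonal_ordered:
  assumes e: "e \<in> steps" and f: "f \<in> steps" and "e \<noteq> f" and le: "start e \<le> start f"
  shows "expectation (\<lambda>w. (diffusion j e w * incr e w) * (diffusion j f w * incr f w)) = 0"
proof -
  \<comment> \<open>\<open>K\<close> holds the cells on which the three factors other than
    \<open>incr f\<close> depend, \<open>K'\<close> those of \<open>incr f\<close>.\<close>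
  define K where "K = past (start f) \<union> {fst e} \<times> fine_steps (start e) (stop e)"
  define K' where "K' = {fst f} \<times> fine_steps (start f) (stop f)"
  have sub: "K \<subseteq> modes \<times> {..<N}" "K' \<subseteq> modes \<times> {..<N}"
    unfolding K_def K'_def using past_subset own_steps_subset[OF e] own_steps_subset[OF f] by auto
  \<comment> \<open>Distinct steps of one mode have distinct indices, so the earlier one is over
    when the later one begins. For different modes the cells already differ in the first
    coordinate.\<close>
  have "stop e \<le> start f" if eq: "fst e = fst f"
  proof -
    have pos: "0 < n (fst e)" "1 \<le> snd e" "1 \<le> snd f" using e f by (auto simp: steps_def)
    then have "snd e - 1 \<le> snd f - 1"
      using le eq by (simp add: start_def divide_le_cancel)
    moreover have "snd e \<noteq> snd f" using eq \<open>e \<noteq> f\<close> by (simp add: prod_eq_iff)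
    ultimately have "snd e \<le> snd f - 1" using pos by linarith
    then show ?thesis using eq by (simp add: start_def stop_def divide_right_mono)
  qed
  then have disj: "K \<inter> K' = {}"
    unfolding K_def K'_def by (auto simp: past_def fine_steps_def)
  have meas: "(\<lambda>w. diffusion j e w * incr e w * diffusion j f w) \<in> borel_measurable (G K)"
  proof (intro borel_measurable_times[OF noise_measurable_G[OF e]])
    show "past (start e) \<union> {fst e} \<times> fine_steps (start e) (stop e) \<subseteq> K"
      using past_mono[OF le] by (auto simp: K_def)
    show "diffusion j f \<in> borel_measurable (G K)"
      by (rule generated_algebra_mono[OF diffusion_measurable[OF f]]) (auto simp: K_def)
  qed
  have int: "integrable M (\<lambda>w. diffusion j e w * incr e w * diffusion j f w)"
    using noise_measurable[OF e] G_measurable_M[OF diffusion_measurable[OF f] past_subset]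
      noise_moments(1)[OF e e e] diffusion_integrable[OF f]
    by (rule square_integrable_mult)
  have incr: "incr f \<in> borel_measurable (G K')"
    using incr_measurable_G[OF f] by (simp add: K'_def)
  show ?thesis
    using expectation_mult_generated_algebra(2)[OF indep_fine_incr disj sub meas incr int
        incr_gaussian(1)[OF f]] incr_gaussian(2)[OF f]
    by (simp add: mult.assoc)
qed

lemma noise_orthogonal:
  assumes "e \<in> steps" "f \<in> steps" "e \<noteq> f"
  shows "expectation (\<lambda>w. (diffusion j e w * incr e w) * (diffusion j f w * incr f w)) = 0"
  using noise_orthogonal_ordered[of e f j] noise_orthogonal_ordered[of f e j] assms
  by (cases "start e \<le> start f") (auto simp: mult.commute)

text \<open>By \<open>noise_moments\<close> this is the second moment of the noise term of step
  \<open>e\<close> in component \<open>j\<close>.\<close>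

definition "energy j e = expectation (\<lambda>w. (diffusion j e w)\<^sup>2) * (stop e - start e)"

lemma energy_nonneg: "e \<in> steps \<Longrightarrow> 0 \<le> energy j e"
  using start_lt_stop[of e] by (simp add: energy_def)

text \<open>The resolvent products are deterministic weights and distinct noise terms are
  orthogonal, so second moments add.\<close>

lemma expectation_X_comp_square:
  "expectation (\<lambda>w. (X_comp j t w)\<^sup>2) = (R j 0 t)\<^sup>2 * (inner xi (h j))\<^sup>2
    + (\<Sum>e\<in>{e \<in> steps. stop e \<le> t}. (R j (start e) t)\<^sup>2 * energy j e)"
  unfolding X_comp_def
  using finite_steps noise_measurable noise_moments noise_orthogonal
  by (subst expectation_square_orthogonal_sum) (auto simp: power_mult_distrib energy_def)

text \<open>For \<open>j\<close> in range the component is the inner product of \<open>X t\<close>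
  with \<open>h j\<close>, and its square is one summand of the squared norm.\<close>

lemma X_comp_square_integrable:
  assumes "j \<in> {1..J} \<inter> I"
  shows "integrable M (\<lambda>w. (X_comp j t w)\<^sup>2)"
proof (rule Bochner_Integration.integrable_bound)
  show "integrable M (\<lambda>w. (norm (X t w))\<^sup>2)" using X_square_integrable by blast
  have "(\<lambda>w. inner (X t w) (h j)) \<in> borel_measurable M"
    using G_measurable_M[OF conjunct1[OF X_square_integrable] past_subset]
    by (intro borel_measurable_inner) auto
  then show "(\<lambda>w. (X_comp j t w)\<^sup>2) \<in> borel_measurable M"
    using assms by (simp add: X_eq inner_basis_sum)
  show "AE w in M. norm ((X_comp j t w)\<^sup>2) \<le> norm ((norm (X t w))\<^sup>2)"
    unfolding X_eq norm_basis_sum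
    using member_le_sum[OF assms, of "\<lambda>j. (X_comp j t w)\<^sup>2" for w]
    by (intro AE_I2) (simp add: sum_nonneg)
qed

section \<open>Summation over the grid times: resolvent weights and smoothing\<close>

lemma resolvent_weights_le_1:
  assumes "j \<in> I"
  shows "(\<Sum>\<eta>\<in>{\<eta>\<in>{1..N}. s < \<tau> \<eta>}. lam j * (\<tau> \<eta> - \<tau> (\<eta> - 1)) * (R j s (\<tau> \<eta>))\<^sup>2) \<le> 1"
proof -
  define x where "x k = lam j * (\<tau> k - \<tau> (k - 1))" for k
  have "R j s (\<tau> \<eta>) = (\<Prod>k\<in>{k\<in>{1..\<eta>}. s < \<tau> k}. 1 / (1 + x k))" if "\<eta> \<in> {1..N}" for \<eta>
  proof -
    \<comment> \<open>On the joint grid, comparing times amounts to comparing indices, which turns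
      the resolvent product into the one of \<open>resolvent_weights_sum_le_1\<close>.\<close>
    have "{k\<in>{1..N}. s < \<tau> k \<and> \<tau> k \<le> \<tau> \<eta>} = {k\<in>{1..\<eta>}. s < \<tau> k}"
      using that tau_le_iff[OF L_pos] by auto
    then show ?thesis by (simp add: resolvent_prod_def x_def)
  qed
  then have "(\<Sum>\<eta>\<in>{\<eta>\<in>{1..N}. s < \<tau> \<eta>}. lam j * (\<tau> \<eta> - \<tau> (\<eta> - 1)) * (R j s (\<tau> \<eta>))\<^sup>2)
      = (\<Sum>\<eta>\<in>{\<eta>\<in>{1..N}. s < \<tau> \<eta>}. x \<eta> * (\<Prod>k\<in>{k\<in>{1..\<eta>}. s < \<tau> k}. 1 / (1 + x k))\<^sup>2)"
    by (intro sum.cong) (auto simp: x_def)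
  also have "\<dots> \<le> 1"
    using lam_pos[OF assms] tau_mono[OF L_pos]
    by (intro resolvent_weights_sum_le_1) (auto simp: x_def)
  finally show ?thesis .
qed

text \<open>Exchange the sums: for each source, the initial value or one noise term, the weights
  over \<open>\<eta>\<close> sum to at most 1.\<close>

lemma mode_bound:
  assumes j: "j \<in> I"
  shows "(\<Sum>\<eta>=1..N. lam j * (\<tau> \<eta> - \<tau> (\<eta> - 1)) * expectation (\<lambda>w. (X_comp j (\<tau> \<eta>) w)\<^sup>2))
    \<le> (inner xi (h j))\<^sup>2 + (\<Sum>e\<in>steps. energy j e)"
proof -
  define x where "x k = lam j * (\<tau> k - \<tau> (k - 1))" for k
  have x: "0 \<le> x \<eta>" if "\<eta> \<in> {1..N}" for \<eta>
    using that lam_pos[OF j] tau_mono[OF L_pos, of "\<eta> - 1" \<eta> n] by (auto simp: x_def)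
  have W: "(\<Sum>\<eta>\<in>{\<eta>\<in>{1..N}. s < \<tau> \<eta>}. x \<eta> * (R j s (\<tau> \<eta>))\<^sup>2) \<le> 1" for s
    using resolvent_weights_le_1[OF j] by (simp add: x_def)
  have "(\<Sum>\<eta>=1..N. x \<eta> * expectation (\<lambda>w. (X_comp j (\<tau> \<eta>) w)\<^sup>2))
      = (\<Sum>\<eta>=1..N. x \<eta> * (R j 0 (\<tau> \<eta>))\<^sup>2) * (inner xi (h j))\<^sup>2
        + (\<Sum>\<eta>=1..N. \<Sum>e\<in>steps. if stop e \<le> \<tau> \<eta> then x \<eta> * (R j (start e) (\<tau> \<eta>))\<^sup>2 * energy j e else 0)"
    unfolding expectation_X_comp_square
    by (simp add: distrib_left sum.distrib sum_distrib_left sum_distrib_right mult.assoc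
        sum.inter_filter[OF finite_steps] if_distrib cong: if_cong)
  also have "\<dots> \<le> (inner xi (h j))\<^sup>2 + (\<Sum>e\<in>steps. energy j e)"
  proof (rule add_mono)
    \<comment> \<open>The initial value is the source at time 0, and all later grid times are
      positive, so the cut-off at 0 excludes no index.\<close>
    have "{\<eta>\<in>{1..N}. 0 < \<tau> \<eta>} = {1..N}" using tau_pos[OF L_pos] by auto
    then show "(\<Sum>\<eta>=1..N. x \<eta> * (R j 0 (\<tau> \<eta>))\<^sup>2) * (inner xi (h j))\<^sup>2 \<le> (inner xi (h j))\<^sup>2"
      using mult_right_mono[OF W[of 0], of "(inner xi (h j))\<^sup>2"] by simp
    have "(\<Sum>\<eta>=1..N. if stop e \<le> \<tau> \<eta> then x \<eta> * (R j (start e) (\<tau> \<eta>))\<^sup>2 * energy j e else 0)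
        \<le> energy j e" if e: "e \<in> steps" for e
    proof -
      \<comment> \<open>The noise term is present from \<open>stop e\<close> on. Enlarging the range
        to \<open>start e < \<tau> \<eta>\<close> adds nonnegative terms and gives the range on
        which the weights are known to sum to at most 1.\<close>
      have "(\<Sum>\<eta>=1..N. if stop e \<le> \<tau> \<eta> then x \<eta> * (R j (start e) (\<tau> \<eta>))\<^sup>2 * energy j e else 0)
          \<le> (\<Sum>\<eta>=1..N. if start e < \<tau> \<eta> then x \<eta> * (R j (start e) (\<tau> \<eta>))\<^sup>2 * energy j e else 0)"
        using start_lt_stop[OF e] energy_nonneg[OF e] x by (intro sum_mono) auto
      also have "\<dots> = (\<Sum>\<eta>\<in>{\<eta>\<in>{1..N}. start e < \<tau> \<eta>}. x \<eta> * (R j (start e) (\<tau> \<eta>))\<^sup>2) * energy j e"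
        unfolding sum_distrib_right by (subst sum.inter_filter) auto
      also have "\<dots> \<le> energy j e"
        using mult_right_mono[OF W energy_nonneg[OF e]] by simp
      finally show ?thesis .
    qed
    then show "(\<Sum>\<eta>=1..N. \<Sum>e\<in>steps.
          if stop e \<le> \<tau> \<eta> then x \<eta> * (R j (start e) (\<tau> \<eta>))\<^sup>2 * energy j e else 0)
        \<le> (\<Sum>e\<in>steps. energy j e)"
      by (subst sum.swap) (intro sum_mono)
  qed
  finally show ?thesis by (simp add: x_def)
qed

text \<open>The extra half power contributes one factor \<open>lam j\<close> to the squared norm,
  and \<open>mode_bound\<close> absorbs this factor into the resolvent weights.\<close>

lemma smoothing_bound:
  "sqrt (\<Sum>\<eta>=1..N. expectation (\<lambda>w. (norm_pow I h lam (r + 1/2) (X (\<tau> \<eta>) w))\<^sup>2) * (\<tau> \<eta> - \<tau> (\<eta> - 1)))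
    \<le> norm_pow I h lam r (eig_proj I h J xi)
      + sqrt (\<Sum>e\<in>steps. \<Sum>j\<in>{1..J} \<inter> I. lam j powr (2 * r) * energy j e)"
proof -
  have powr: "lam j powr (2 * (r + 1/2)) = lam j powr (2 * r) * lam j" if "j \<in> I" for j
    using lam_pos[OF that] by (simp add: distrib_left powr_add)
  have "(\<Sum>\<eta>=1..N. expectation (\<lambda>w. (norm_pow I h lam (r + 1/2) (X (\<tau> \<eta>) w))\<^sup>2) * (\<tau> \<eta> - \<tau> (\<eta> - 1)))
      = (\<Sum>\<eta>=1..N. \<Sum>j\<in>{1..J} \<inter> I. lam j powr (2 * r)
          * (lam j * (\<tau> \<eta> - \<tau> (\<eta> - 1)) * expectation (\<lambda>w. (X_comp j (\<tau> \<eta>) w)\<^sup>2)))"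
  proof (rule sum.cong[OF refl])
    fix \<eta>
    have "expectation (\<lambda>w. (norm_pow I h lam (r + 1/2) (X (\<tau> \<eta>) w))\<^sup>2)
        = (\<Sum>j\<in>{1..J} \<inter> I. lam j powr (2 * (r + 1/2)) * expectation (\<lambda>w. (X_comp j (\<tau> \<eta>) w)\<^sup>2))"
      unfolding X_eq norm_pow_basis_sum
      using X_comp_square_integrable by (subst Bochner_Integration.integral_sum) auto
    also have "\<dots> = (\<Sum>j\<in>{1..J} \<inter> I. lam j powr (2 * r) * lam j * expectation (\<lambda>w. (X_comp j (\<tau> \<eta>) w)\<^sup>2))"
      using powr by (intro sum.cong) auto
    finally have "expectation (\<lambda>w. (norm_pow I h lam (r + 1/2) (X (\<tau> \<eta>) w))\<^sup>2)
        = (\<Sum>j\<in>{1..J} \<inter> I. lam j powr (2 * r) * lam j * expectation (\<lambda>w. (X_comp j (\<tau> \<eta>) w)\<^sup>2))" .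
    then show "expectation (\<lambda>w. (norm_pow I h lam (r + 1/2) (X (\<tau> \<eta>) w))\<^sup>2) * (\<tau> \<eta> - \<tau> (\<eta> - 1))
        = (\<Sum>j\<in>{1..J} \<inter> I. lam j powr (2 * r)
          * (lam j * (\<tau> \<eta> - \<tau> (\<eta> - 1)) * expectation (\<lambda>w. (X_comp j (\<tau> \<eta>) w)\<^sup>2)))"
      by (simp only: sum_distrib_right) (simp only: mult_ac)
  qed
  also have "\<dots> = (\<Sum>j\<in>{1..J} \<inter> I. lam j powr (2 * r)
      * (\<Sum>\<eta>=1..N. lam j * (\<tau> \<eta> - \<tau> (\<eta> - 1)) * expectation (\<lambda>w. (X_comp j (\<tau> \<eta>) w)\<^sup>2)))"
    by (subst sum.swap) (simp add: sum_distrib_left)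
  also have "\<dots> \<le> (\<Sum>j\<in>{1..J} \<inter> I. lam j powr (2 * r) * ((inner xi (h j))\<^sup>2 + (\<Sum>e\<in>steps. energy j e)))"
    by (intro sum_mono mult_left_mono mode_bound) auto
  also have "\<dots> = (norm_pow I h lam r (eig_proj I h J xi))\<^sup>2
      + (\<Sum>e\<in>steps. \<Sum>j\<in>{1..J} \<inter> I. lam j powr (2 * r) * energy j e)"
    unfolding norm_pow_eig_proj distrib_left sum.distrib
    by (simp add: sum_distrib_left sum.swap[of "\<lambda>e j. lam j powr (2 * r) * energy j e" _ steps])
  finally have "sqrt (\<Sum>\<eta>=1..N. expectation (\<lambda>w. (norm_pow I h lam (r + 1/2) (X (\<tau> \<eta>) w))\<^sup>2)
        * (\<tau> \<eta> - \<tau> (\<eta> - 1)))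
      \<le> sqrt ((norm_pow I h lam r (eig_proj I h J xi))\<^sup>2
        + (\<Sum>e\<in>steps. \<Sum>j\<in>{1..J} \<inter> I. lam j powr (2 * r) * energy j e))"
    by simp
  \<comment> \<open>Subadditivity of the square root separates the initial value from the
    noise.\<close>
  also have "\<dots> \<le> norm_pow I h lam r (eig_proj I h J xi)
      + sqrt (\<Sum>e\<in>steps. \<Sum>j\<in>{1..J} \<inter> I. lam j powr (2 * r) * energy j e)"
  proof -
    have "0 \<le> norm_pow I h lam r (eig_proj I h J xi)"
      by (simp add: norm_pow_def infsum_nonneg)
    then show ?thesis
      using sqrt_add_le_add_sqrt[of "(norm_pow I h lam r (eig_proj I h J xi))\<^sup>2"
          "\<Sum>e\<in>steps. \<Sum>j\<in>{1..J} \<inter> I. lam j powr (2 * r) * energy j e"]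
      by (simp add: sum_nonneg energy_nonneg)
  qed
  finally show ?thesis .
qed

end


section \<open>Noise energy and the uniform scheme\<close>

context euler_scheme
begin

lemma sum_steps: "(\<Sum>e\<in>steps. f e) = (\<Sum>l\<in>modes. \<Sum>i=1..n l. f (l, i))"
  unfolding steps_def by (subst sum.Sigma) auto

text \<open>Beyond \<open>L\<close> the projected basis vector is 0 and \<open>B_zero\<close>
  removes the term; within \<open>modes\<close> the projection changes nothing.\<close>

lemma norm_pow_noise:
  assumes "l \<in> I" "t \<in> {0..1}"
  shows "(norm_pow I h lam r (eig_proj I h J (B t u (eig_proj I h L (sqrt (q l) *\<^sub>R h l)))))\<^sup>2
    = (if l \<in> modes
       then \<Sum>j\<in>{1..J} \<inter> I. lam j powr (2 * r) * (inner (B t u (sqrt (q l) *\<^sub>R h l)) (h j))\<^sup>2 else 0)"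
  unfolding norm_pow_eig_proj eig_proj_basis[OF assms(1)]
  using B_zero[OF assms(2)] by simp

lemma infsum_modes:
  fixes f :: "nat \<Rightarrow> real"
  assumes "\<And>l. l \<in> I \<Longrightarrow> f l = (if l \<in> modes then g l else 0)"
  shows "(\<Sum>\<^sub>\<infinity>l\<in>I. f l) = (\<Sum>l\<in>modes. g l)"
proof -
  have "(\<Sum>\<^sub>\<infinity>l\<in>I. f l) = (\<Sum>\<^sub>\<infinity>l\<in>modes. g l)"
    using assms by (intro infsum_cong_neutral) auto
  then show ?thesis by simp
qed

text \<open>The sum over all modes reduces to a finite one, and integrability of the squared
  coefficients lets the expectation pass through it. This identifies the noise term of the claim
  with the total energy.\<close>

lemma expected_noise_energy:
  "expectation (\<lambda>w. \<Sum>\<^sub>\<infinity>l\<in>I. \<Sum>i=1..n l.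
      (norm_pow I h lam r (eig_proj I h J (B (real (i - 1) / real (n l)) (X (real (i - 1) / real (n l)) w)
        (eig_proj I h L (sqrt (q l) *\<^sub>R h l)))))\<^sup>2 * (real i / real (n l) - real (i - 1) / real (n l)))
    = (\<Sum>e\<in>steps. \<Sum>j\<in>{1..J} \<inter> I. lam j powr (2 * r) * energy j e)"
proof -
  have "(\<lambda>w. \<Sum>\<^sub>\<infinity>l\<in>I. \<Sum>i=1..n l.
      (norm_pow I h lam r (eig_proj I h J (B (real (i - 1) / real (n l)) (X (real (i - 1) / real (n l)) w)
        (eig_proj I h L (sqrt (q l) *\<^sub>R h l)))))\<^sup>2 * (real i / real (n l) - real (i - 1) / real (n l)))
    = (\<lambda>w. \<Sum>l\<in>modes. \<Sum>i=1..n l. (\<Sum>j\<in>{1..J} \<inter> I. lam j powr (2 * r) * (diffusion j (l, i) w)\<^sup>2)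
        * (stop (l, i) - start (l, i)))"
  proof (intro ext infsum_modes)
    fix w l assume l: "l \<in> I"
    \<comment> \<open>Beyond \<open>L\<close> the value \<open>n l\<close> is arbitrary, possibly 0;
      then \<open>i\<close> has empty range, so every time that occurs still lies in
      \<open>{0..1}\<close>.\<close>
    have "real (i - 1) / real (n l) \<in> {0..1}" if "i \<in> {1..n l}" for i
      using that by (auto simp: divide_le_eq_1)
    then have *: "(norm_pow I h lam r (eig_proj I h J (B (real (i - 1) / real (n l)) (X (real (i - 1) / real (n l)) w)
        (eig_proj I h L (sqrt (q l) *\<^sub>R h l)))))\<^sup>2 * (real i / real (n l) - real (i - 1) / real (n l))
      = (if l \<in> modes then \<Sum>j\<in>{1..J} \<inter> I. lam j powr (2 * r) * (diffusion j (l, i) w)\<^sup>2 else 0)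
        * (stop (l, i) - start (l, i))" if "i \<in> {1..n l}" for i
      using that by (simp only: norm_pow_noise[OF l] diffusion_def start_def stop_def fst_conv snd_conv)
    show "(\<Sum>i=1..n l.
      (norm_pow I h lam r (eig_proj I h J (B (real (i - 1) / real (n l)) (X (real (i - 1) / real (n l)) w)
        (eig_proj I h L (sqrt (q l) *\<^sub>R h l)))))\<^sup>2 * (real i / real (n l) - real (i - 1) / real (n l)))
      = (if l \<in> modes then \<Sum>i=1..n l. (\<Sum>j\<in>{1..J} \<inter> I. lam j powr (2 * r) * (diffusion j (l, i) w)\<^sup>2)
        * (stop (l, i) - start (l, i)) else 0)"
      by (subst sum.cong[OF refl *], assumption, cases "l \<in> modes")
        (simp_all only: if_True if_False mult_zero_left sum.neutral_const)
  qed
  also have "\<dots> = (\<lambda>w. \<Sum>e\<in>steps. \<Sum>j\<in>{1..J} \<inter> I. lam j powr (2 * r) * ((diffusion j e w)\<^sup>2 * (stop e - start e)))"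
    by (simp add: sum_steps sum_distrib_right mult.assoc)
  finally show ?thesis
    using diffusion_integrable by (simp add: energy_def)
qed

end

section \<open>The uniform grid and the one-step recursion\<close>

lemma grid_uniform:
  assumes "1 \<le> L"
  shows "grid L (\<lambda>_. m) = (\<lambda>i. real i / real m) ` {..m}"
  using assms by (auto simp: grid_def atLeast0AtMost)

text \<open>The list of quotients is sorted and distinct, hence the sorted list of its own elements;
  this makes \<open>tau\<close> and \<open>num_steps\<close> explicit.\<close>

lemma sorted_list_grid_uniform:
  assumes "1 \<le> L" "1 \<le> m"
  shows "sorted_list_of_set (grid L (\<lambda>_. m)) = map (\<lambda>i. real i / real m) [0..<Suc m]"
proof (rule sorted_list_of_set.idem_if_sorted_distinct[of "map (\<lambda>i. real i / real m) [0..<Suc m]",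
      THEN trans[rotated]])
  show "sorted_list_of_set (grid L (\<lambda>_. m))
      = sorted_list_of_set (set (map (\<lambda>i. real i / real m) [0..<Suc m]))"
    unfolding grid_uniform[OF assms(1)] by (simp add: atLeast0LessThan lessThan_Suc_atMost del: upt_Suc)
  show "sorted (map (\<lambda>i. real i / real m) [0..<Suc m])"
    by (auto simp: sorted_iff_nth_mono divide_right_mono simp del: upt_Suc)
  show "distinct (map (\<lambda>i. real i / real m) [0..<Suc m])"
    using assms(2) by (auto simp: distinct_map inj_on_def simp del: upt_Suc)
qed

lemma tau_uniform: "1 \<le> L \<Longrightarrow> 1 \<le> m \<Longrightarrow> k \<le> m \<Longrightarrow> tau L (\<lambda>_. m) k = real k / real m"
  by (simp add: tau_def sorted_list_grid_uniform nth_append del: upt_Suc)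

lemma num_steps_uniform: "1 \<le> L \<Longrightarrow> 1 \<le> m \<Longrightarrow> num_steps L (\<lambda>_. m) = m"
  unfolding num_steps_def sorted_list_of_set.length_sorted_key_list_of_set[symmetric]
  by (simp add: sorted_list_grid_uniform del: upt_Suc)

text \<open>All cells have length \<open>1 / m\<close>, so the factors coincide. For
  \<open>a \<ge> i\<close> the product is empty and the truncated exponent is 0.\<close>

lemma resolvent_prod_uniform:
  assumes "1 \<le> L" "1 \<le> m" "i \<le> m"
  shows "resolvent_prod lam L (\<lambda>_. m) j (real a / real m) (real i / real m)
    = inverse (1 + lam j / real m) ^ (i - a)"
proof -
  have "{k \<in> {1..m}. real a / real m < tau L (\<lambda>_. m) k \<and> tau L (\<lambda>_. m) k \<le> real i / real m} = {a<..i}"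
    using assms by (auto simp: tau_uniform divide_less_cancel divide_le_cancel)
  moreover have "1 / (1 + lam j * (tau L (\<lambda>_. m) k - tau L (\<lambda>_. m) (k - 1))) = inverse (1 + lam j / real m)"
    if "k \<in> {a<..i}" for k
  proof -
    have "tau L (\<lambda>_. m) k - tau L (\<lambda>_. m) (k - 1) = (real k - real (k - 1)) / real m"
      using that assms by (subst (1 2) tau_uniform) (auto simp: diff_divide_distrib)
    also have "real k - real (k - 1) = 1" using that by auto
    finally show ?thesis by (simp add: inverse_eq_divide)
  qed
  ultimately show ?thesis
    using assms by (simp add: resolvent_prod_def num_steps_uniform)
qed

locale uniform_euler_scheme = euler_scheme M I h lam q B beta xi J L C "\<lambda>_. m"
  for M :: "'w measure" and I h lam q and B :: "real \<Rightarrow> 'h \<Rightarrow> 'h \<Rightarrow> 'h::{real_inner, second_countable_topology}"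
    and beta xi J L C and m :: nat +
  assumes m_pos: "1 \<le> m"
begin

abbreviation "Xu \<equiv> X_bar I h lam q B beta xi J L m"

text \<open>Passing to the next time multiplies every old resolvent product by one more factor,
  while the noise with index \<open>Suc i\<close> starts at \<open>i / m\<close> and receives
  exactly one.\<close>

lemma X_comp_Suc:
  assumes "i < m"
  shows "X_comp j (real (Suc i) / real m) w = inverse (1 + lam j / real m) *
    (X_comp j (real i / real m) w + (\<Sum>l\<in>modes. diffusion j (l, Suc i) w * incr (l, Suc i) w))"
proof -
  let ?r = "inverse (1 + lam j / real m)"
  let ?f = "\<lambda>t e. R j (start e) t * (diffusion j e w * incr e w)"
  have R0: "R j 0 (real k / real m) = ?r ^ k" if "k \<le> m" for k
    using resolvent_prod_uniform[OF L_pos m_pos that, of lam j 0] by simp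
  have Re: "R j (start e) (real k / real m) = ?r ^ (k - (snd e - 1))" if "k \<le> m" for e k
    using resolvent_prod_uniform[OF L_pos m_pos that, of lam j "snd e - 1"] by (simp add: start_def)
  have le: "stop e \<le> real k / real m \<longleftrightarrow> snd e \<le> k" for e k
    using m_pos by (simp add: stop_def divide_le_cancel)
  have split: "{e \<in> steps. snd e \<le> Suc i} = {e \<in> steps. snd e \<le> i} \<union> (\<lambda>l. (l, Suc i)) ` modes"
    using assms by (auto simp: steps_def le_Suc_eq)
  have "(\<Sum>e\<in>{e \<in> steps. snd e \<le> Suc i}. ?f (real (Suc i) / real m) e)
      = (\<Sum>e\<in>{e \<in> steps. snd e \<le> i}. ?f (real (Suc i) / real m) e)
        + (\<Sum>l\<in>modes. ?f (real (Suc i) / real m) (l, Suc i))"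
    unfolding split using finite_steps
    by (subst sum.union_disjoint) (auto simp: sum.reindex inj_on_def)
  also have "(\<Sum>e\<in>{e \<in> steps. snd e \<le> i}. ?f (real (Suc i) / real m) e)
      = (\<Sum>e\<in>{e \<in> steps. snd e \<le> i}. ?r * ?f (real i / real m) e)"
  proof (rule sum.cong[OF refl])
    fix e assume "e \<in> {e \<in> steps. snd e \<le> i}"
    \<comment> \<open>Here \<open>snd e \<le> i\<close>, so no truncation occurs in the exponents
      and they differ by exactly 1.\<close>
    then have "Suc i - (snd e - 1) = Suc (i - (snd e - 1))" by auto
    then show "?f (real (Suc i) / real m) e = ?r * ?f (real i / real m) e"
      using assms Re[of i e] Re[of "Suc i" e] by simp
  qed
  also have "(\<Sum>l\<in>modes. ?f (real (Suc i) / real m) (l, Suc i))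
      = (\<Sum>l\<in>modes. ?r * (diffusion j (l, Suc i) w * incr (l, Suc i) w))"
    using assms Re[of "Suc i"] by simp
  finally show ?thesis
    unfolding X_comp_def le using assms R0[of i] R0[of "Suc i"]
    by (simp add: sum_distrib_left distrib_left)
qed

text \<open>The induction treats all components at once, because \<open>B\<close> at time
  \<open>i / m\<close> sees the entire state.\<close>

lemma X_bar_comp_eq:
  assumes "i \<le> m" "j \<in> {1..J} \<inter> I"
  shows "X_bar_comp I h lam q B beta xi J L m i w j = X_comp j (real i / real m) w"
  using assms
proof (induction i arbitrary: j)
  case 0
  have no_steps: "{e \<in> steps. stop e \<le> 0} = {}"
    using start_lt_stop start_bounds by fastforce
  then show ?case
    using resolvent_prod_uniform[OF L_pos m_pos, of 0 lam j 0] by (simp add: X_comp_def no_steps)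
next
  case (Suc i)
  have "(\<Sum>k\<in>{1..J} \<inter> I. X_bar_comp I h lam q B beta xi J L m i w k *\<^sub>R h k) = X (real i / real m) w"
    unfolding X_eq using Suc by (intro sum.cong) auto
  then show ?case
    using Suc by (simp add: X_comp_Suc diffusion_def incr_def start_def stop_def del: of_nat_Suc)
qed

lemma X_bar_eq: "i \<le> m \<Longrightarrow> Xu i w = X (real i / real m) w"
  unfolding X_bar_def X_eq by (intro sum.cong) (auto simp: X_bar_comp_eq)

text \<open>Here the expectation stands inside the sum over time; the squared Hilbert-Schmidt norm
  expands over the modes, and exchanging the sums over \<open>i\<close> and \<open>l\<close> gives
  the same total energy.\<close>

lemma expected_noise_energy_uniform:
  "(\<Sum>i=1..m. expectation (\<lambda>w. (HS_norm I h q (norm_pow I h lam r)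
      (\<lambda>g. eig_proj I h J (B (real (i - 1) / real m) (Xu (i - 1) w) (eig_proj I h L g))))\<^sup>2)
      * (real i / real m - real (i - 1) / real m))
    = (\<Sum>e\<in>steps. \<Sum>j\<in>{1..J} \<inter> I. lam j powr (2 * r) * energy j e)"
proof -
  have "expectation (\<lambda>w. (HS_norm I h q (norm_pow I h lam r)
      (\<lambda>g. eig_proj I h J (B (real (i - 1) / real m) (Xu (i - 1) w) (eig_proj I h L g))))\<^sup>2)
      * (real i / real m - real (i - 1) / real m)
    = (\<Sum>l\<in>modes. \<Sum>j\<in>{1..J} \<inter> I. lam j powr (2 * r) * energy j (l, i))" if i: "i \<in> {1..m}" for i
  proof -
    have t: "real (i - 1) / real m \<in> {0..1}" using i by (auto simp: divide_le_eq_1)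
    have "(HS_norm I h q (norm_pow I h lam r)
        (\<lambda>g. eig_proj I h J (B (real (i - 1) / real m) (Xu (i - 1) w) (eig_proj I h L g))))\<^sup>2
      = (\<Sum>l\<in>modes. \<Sum>j\<in>{1..J} \<inter> I. lam j powr (2 * r) * (diffusion j (l, i) w)\<^sup>2)" for w
    proof -
      have "(\<Sum>\<^sub>\<infinity>l\<in>I. (norm_pow I h lam r (eig_proj I h J (B (real (i - 1) / real m) (Xu (i - 1) w)
          (eig_proj I h L (sqrt (q l) *\<^sub>R h l)))))\<^sup>2)
        = (\<Sum>l\<in>modes. \<Sum>j\<in>{1..J} \<inter> I. lam j powr (2 * r) * (diffusion j (l, i) w)\<^sup>2)"
      proof (rule infsum_modes)
        have "i - 1 \<le> m" using i by auto
        then show "(norm_pow I h lam r (eig_proj I h J (B (real (i - 1) / real m) (Xu (i - 1) w)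
            (eig_proj I h L (sqrt (q l) *\<^sub>R h l)))))\<^sup>2
          = (if l \<in> modes then \<Sum>j\<in>{1..J} \<inter> I. lam j powr (2 * r) * (diffusion j (l, i) w)\<^sup>2 else 0)"
          if "l \<in> I" for l
          unfolding norm_pow_noise[OF that t] by (simp add: X_bar_eq diffusion_def start_def del: of_nat_diff)
      qed
      then show ?thesis by (simp add: HS_norm_def sum_nonneg)
    qed
    then have "expectation (\<lambda>w. (HS_norm I h q (norm_pow I h lam r)
        (\<lambda>g. eig_proj I h J (B (real (i - 1) / real m) (Xu (i - 1) w) (eig_proj I h L g))))\<^sup>2)
      = (\<Sum>l\<in>modes. \<Sum>j\<in>{1..J} \<inter> I. lam j powr (2 * r) * expectation (\<lambda>w. (diffusion j (l, i) w)\<^sup>2))"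
      using diffusion_integrable i by (simp add: steps_iff)
    moreover have "stop (l, i) - start (l, i) = real i / real m - real (i - 1) / real m" for l
      by (simp add: start_def stop_def)
    ultimately show ?thesis
      by (simp add: energy_def sum_distrib_right mult.assoc del: of_nat_diff)
  qed
  then show ?thesis
    unfolding sum_steps by (subst sum.swap) simp
qed

lemma smoothing_bound_uniform:
  "sqrt (\<Sum>i=1..m. expectation (\<lambda>w. (norm_pow I h lam (r + 1/2) (Xu i w))\<^sup>2)
      * (real i / real m - real (i - 1) / real m))
    \<le> norm_pow I h lam r (eig_proj I h J xi)
      + sqrt (\<Sum>e\<in>steps. \<Sum>j\<in>{1..J} \<inter> I. lam j powr (2 * r) * energy j e)"
proof -
  have "(\<Sum>i=1..m. expectation (\<lambda>w. (norm_pow I h lam (r + 1/2) (Xu i w))\<^sup>2)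
      * (real i / real m - real (i - 1) / real m))
    = (\<Sum>\<eta>=1..N. expectation (\<lambda>w. (norm_pow I h lam (r + 1/2) (X (\<tau> \<eta>) w))\<^sup>2) * (\<tau> \<eta> - \<tau> (\<eta> - 1)))"
    using L_pos m_pos
    by (intro sum.cong) (auto simp: num_steps_uniform tau_uniform X_bar_eq simp del: of_nat_diff)
  then show ?thesis using smoothing_bound by simp
qed

end

section \<open>From the stated assumptions to the setting of the scheme\<close>

text \<open>The measurability clause contains this: a measurable map takes values in the target
  space, which for \<open>HS_borel\<close> is the set of Hilbert-Schmidt operators.\<close>

lemma assumption_B_HS:
  assumes "assumption_B I h lam q r B" "t \<in> {0..1}"
  shows "B t u \<in> HS I h q UNIV norm"
proof -
  have "(\<lambda>(t, u). B t u) \<in> measurable (restrict_space borel ({0..1} \<times> UNIV)) (HS_borel I h q)"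
    using assms(1) by (simp add: assumption_B_def)
  from measurable_space[OF this, of "(t, u)"] have "B t u \<in> space (HS_borel I h q)"
    using assms(2) by (simp add: space_restrict_space)
  also have "space (HS_borel I h q) = HS I h q UNIV norm"
    unfolding HS_borel_def by (rule space_measure_of) auto
  finally show ?thesis .
qed

text \<open>Linearity is available on \<open>H0\<close> only, so 0 must first be recognised as an
  element of it.\<close>

lemma HS_zero:
  assumes "T \<in> HS I h q K nK"
  shows "T 0 = 0"
proof -
  have "Q_half I h q 0 = 0" by (simp add: Q_half_def)
  then have "0 \<in> H0 I h q" unfolding H0_def by (metis rangeI)
  then have "T (0 *\<^sub>R 0) = 0 *\<^sub>R T 0" using assms unfolding HS_def by blast
  then show ?thesis by simp
qed

lemma norm_le_HS_norm_diff:
  assumes "S \<in> HS I h q UNIV norm" "T \<in> HS I h q UNIV norm" "l \<in> I"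
  shows "norm (S (sqrt (q l) *\<^sub>R h l) - T (sqrt (q l) *\<^sub>R h l)) \<le> HS_norm I h q norm (\<lambda>g. S g - T g)"
proof -
  let ?a = "\<lambda>l. S (sqrt (q l) *\<^sub>R h l)" and ?b = "\<lambda>l. T (sqrt (q l) *\<^sub>R h l)"
  \<comment> \<open>A divergent infinite sum has the default value 0, so a summand can be compared
    with the sum only after summability is shown; it follows from that of both operators.\<close>
  have "(\<lambda>l. 2 * (norm (?a l))\<^sup>2 + 2 * (norm (?b l))\<^sup>2) summable_on I"
    using assms(1,2) unfolding HS_def by (intro summable_on_add summable_on_cmult_right) auto
  moreover have "(norm (?a l - ?b l))\<^sup>2 \<le> 2 * (norm (?a l))\<^sup>2 + 2 * (norm (?b l))\<^sup>2" for l
  proof -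
    have "(norm (?a l - ?b l))\<^sup>2 \<le> (norm (?a l) + norm (?b l))\<^sup>2"
      by (intro power_mono norm_triangle_ineq4) auto
    then show ?thesis
      using sum_squares_bound[of "norm (?a l)" "norm (?b l)"] by (simp add: power2_sum)
  qed
  ultimately have "(\<lambda>l. (norm (?a l - ?b l))\<^sup>2) summable_on I"
    by (rule summable_on_comparison_test) auto
  from finite_sum_le_infsum[OF this, of "{l}"] assms(3)
  have "(norm (?a l - ?b l))\<^sup>2 \<le> (\<Sum>\<^sub>\<infinity>l\<in>I. (norm (?a l - ?b l))\<^sup>2)" by simp
  then show ?thesis
    unfolding HS_norm_def by (intro real_le_rsqrt)
qed

text \<open>\<open>C\<close> is the Lipschitz constant of \<open>B\<close>, chosen ahead of
  \<open>n\<close>. The locale predicate carries neither \<open>xi\<close> nor \<open>J\<close>, so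
  one instance covers every initial value and spatial truncation.\<close>

lemma euler_scheme_setting:
  fixes h :: "nat \<Rightarrow> 'h::{real_inner, complete_space, second_countable_topology}"
  assumes sp: "spectral_setting I D A h lam" and wi: "wiener_setting M F I h Q q W beta"
    and B: "assumption_B I h lam q r B"
    and L: "1 \<le> L"
  obtains C where "\<And>n. (\<And>l. l \<in> {1..L} \<Longrightarrow> 1 \<le> n l) \<Longrightarrow> euler_scheme M I h lam q B beta L C n"
proof -
  obtain C where C: "\<forall>t\<in>{0..1}. \<forall>u v. HS_norm I h q norm (\<lambda>g. B t u g - B t v g) \<le> C * norm (u - v)"
    using B unfolding assumption_B_def by blast
  interpret prob_space M using wi by (simp add: wiener_setting_def)
  have "norm (B t u (sqrt (q l) *\<^sub>R h l) - B t v (sqrt (q l) *\<^sub>R h l)) \<le> C * norm (u - v)"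
    if "t \<in> {0..1}" "l \<in> I" for t u v l
    using norm_le_HS_norm_diff[OF assumption_B_HS[OF B that(1)] assumption_B_HS[OF B that(1)] that(2)] C that(1)
    by (meson order_trans)
  then have "euler_scheme M I h lam q B beta L C n" if "\<And>l. l \<in> {1..L} \<Longrightarrow> 1 \<le> n l" for n
    using sp wi HS_zero[OF assumption_B_HS[OF B]] L that
    by unfold_locales (auto simp: spectral_setting_def wiener_setting_def)
  then show ?thesis by (rule that)
qed


theorem corollary4p6:
  "\<exists>C>0.
    \<forall>(I :: nat set) (D :: 'h::{real_inner, complete_space, second_countable_topology} set)
     (A :: 'h \<Rightarrow> 'h) (h :: nat \<Rightarrow> 'h) (lam :: nat \<Rightarrow> real)
     (M :: 'w measure) (F :: real \<Rightarrow> 'w measure) (Q :: 'h \<Rightarrow> 'h) (q :: nat \<Rightarrow> real)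
     (W :: real \<Rightarrow> 'w \<Rightarrow> 'h) (beta :: nat \<Rightarrow> real \<Rightarrow> 'w \<Rightarrow> real)
     (\<iota> :: real) (B :: real \<Rightarrow> 'h \<Rightarrow> 'h \<Rightarrow> 'h) (xi :: 'h) (J :: nat) (L :: nat).
      spectral_setting I D A h lam \<longrightarrow>
      wiener_setting M F I h Q q W beta \<longrightarrow>
      0 \<le> \<iota> \<and> \<iota> \<le> 1/2 \<longrightarrow>
      assumption_B I h lam q \<iota> B \<longrightarrow>
      xi \<in> Dom_pow I h lam \<iota> \<longrightarrow>
      1 \<le> J \<longrightarrow> 1 \<le> L \<longrightarrow>
      (\<forall>n :: nat \<Rightarrow> nat. (\<forall>l\<in>{1..L}. 1 \<le> n l) \<longrightarrow>
        (let X = X_hat I h lam q B beta xi J L n; \<tau> = tau L n; t = (\<lambda>i l. real i / real (n l))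
         in sqrt (\<Sum>\<eta>=1..num_steps L n.
                    (\<integral>w. (norm_pow I h lam (\<iota> + 1/2) (X (\<tau> \<eta>) w))\<^sup>2 \<partial>M) * (\<tau> \<eta> - \<tau> (\<eta> - 1)))
            \<le> C * (norm_pow I h lam \<iota> (eig_proj I h J xi)
               + sqrt (\<integral>w. (\<Sum>\<^sub>\<infinity>l\<in>I. \<Sum>i=1..n l.
                     (norm_pow I h lam \<iota>
                        (eig_proj I h J (B (t (i - 1) l) (X (t (i - 1) l) w)
                                       (eig_proj I h L (sqrt (q l) *\<^sub>R h l)))))\<^sup>2
                     * (t i l - t (i - 1) l)) \<partial>M))))
      \<and>
      (\<forall>N\<ge>1.
        (let X = X_bar I h lam q B beta xi J L N; t = (\<lambda>i. real i / real N)
         in sqrt (\<Sum>i=1..N.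
                    (\<integral>w. (norm_pow I h lam (\<iota> + 1/2) (X i w))\<^sup>2 \<partial>M) * (t i - t (i - 1)))
            \<le> C * (norm_pow I h lam \<iota> (eig_proj I h J xi)
               + sqrt (\<Sum>i=1..N.
                    (\<integral>w. (HS_norm I h q (norm_pow I h lam \<iota>)
                       (\<lambda>g. eig_proj I h J (B (t (i - 1)) (X (i - 1) w) (eig_proj I h L g))))\<^sup>2 \<partial>M)
                    * (t i - t (i - 1))))))"
proof (rule exI[of _ 1], intro conjI allI impI, goal_cases)
  case 1
  show ?case by simp
next
  case (2 I D A h lam M F Q q W beta \<iota> B xi J L n)
  \<comment> \<open>This \<open>C\<close> is the Lipschitz constant of \<open>B\<close> and depends
    on the data; the constant of the estimate is the 1 supplied as witness.\<close>
  obtain C where "\<And>n. (\<And>l. l \<in> {1..L} \<Longrightarrow> 1 \<le> n l) \<Longrightarrow> euler_scheme M I h lam q B beta L C n"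
    using euler_scheme_setting[OF 2(1,2,4,7)] by blast
  then interpret euler_scheme M I h lam q B beta xi J L C n
    using 2(8) by blast
  show ?case
    using smoothing_bound[of \<iota>] unfolding Let_def expected_noise_energy by simp
next
  case (3 I D A h lam M F Q q W beta \<iota> B xi J L m)
  obtain C where "\<And>n. (\<And>l. l \<in> {1..L} \<Longrightarrow> 1 \<le> n l) \<Longrightarrow> euler_scheme M I h lam q B beta L C n"
    using euler_scheme_setting[OF 3(1,2,4,7)] by blast
  then interpret uniform_euler_scheme M I h lam q B beta xi J L C m
    using 3(8) by (auto simp: uniform_euler_scheme_def uniform_euler_scheme_axioms_def)
  show ?case
    using smoothing_bound_uniform[of \<iota>] unfolding Let_def expected_noise_energy_uniform by simp
qed

end
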